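(* Let $n\geq 1$, $\chi\in\mathcal{N}_q(n)$ and $X=X(\chi)$. Then the composition $\lambda(\chi)\mu(X):\mathbb{C}[B_q(n-1)]\to W(\chi)$ is a linear isomorphism satisfying $\lambda(\chi)\mu(X)\big(q\,\mathcal{A}_q(n-1)(v)\big)=\mathcal{A}_q(n+1)\big(\lambda(\chi)\mu(X)(v)\big)$ for all $v\in\mathbb{C}[B_q(n-1)]$.
   Context: $q$ is a prime power. For $m\geq 0$, $\mathbb{F}_q^m$ is the space of column vectors of length $m$ over $\mathbb{F}_q$ with standard basis $e_1,\dots,e_m$; for $k<m$, $\mathbb{F}_q^k$ is identified with the subspace of $\mathbb{F}_q^m$ of vectors whose last $m-k$ coordinates are zero. $B_q(m)$ is the set of all subspaces of $\mathbb{F}_q^m$, and for a finite-dimensional $\mathbb{F}_q$-space $X$, $B_q(X)$ is the set of its subspaces. For a finite set $S$, $\mathbb{C}[S]$ is the complex vector space with basis $S$. $Z'$ covers $Z$ means $Z\subseteq Z'$ and $\dim Z'=\dim Z+1$. For $m\geq0$, $\mathcal{A}_q(m):\mathbb{C}[B_q(m)]\to\mathbb{C}[B_q(m)]$ is the linear map with $\mathcal{A}_q(m)(Z)=\sum_{Z' \text{ covers } Z}Z'+q^{\dim Z-1}\sum_{Z \text{ covers } Z'}Z'$ (sums over $Z'\in B_q(m)$). $A_q(n+1)=\{Y\in B_q(n+1): Y\not\subseteq \mathbb{F}_q^n\}$; $\mathbb{C}[A_q(n+1)]\subseteq\mathbb{C}[B_q(n+1)]$. For $Z\in B_q(n)$,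 $\widehat{Z}$ is the span of $Z$ and $e_{n+1}$. $H(n+1,\mathbb{F}_q)$ is the group of matrices $\begin{pmatrix} I_n & a\\ 0 & 1\end{pmatrix}$, $a\in\mathbb{F}_q^n$, acting on $A_q(n+1)$ by $Y\mapsto gY$ and linearly on $\mathbb{C}[A_q(n+1)]$. $\mathcal{N}_q(n)$ is the set of nontrivial homomorphisms $\chi:H(n+1,\mathbb{F}_q)\to\mathbb{C}^*$; $p(\chi)(v)=\sum_{g}\overline{\chi(g)}\,gv$ on $\mathbb{C}[A_q(n+1)]$; $W(\chi)=\{v\in\mathbb{C}[A_q(n+1)]: gv=\chi(g)v\ \forall g\}$. It is a fact that there is a unique $(n-1)$-dimensional subspace $X(\chi)\subseteq\mathbb{F}_q^n$ with $p(\chi)(\widehat{X(\chi)})\neq0$. $\lambda(\chi):\mathbb{C}[B_q(X(\chi))]\to\mathbb{C}[A_q(n+1)]$ is the linear map $Y\mapsto q^{-\dim Y}p(\chi)(\widehat{Y})$. For an $(n-1)$-dimensional subspace $X$ of $\mathbb{F}_q^n$, $M(X)$ is the unique $n\times(n-1)$ matrix in Schubert normal form (every column nonzero; the last nonzero entry of column $j$ is a $1$, in row $r_j$; $r_1<\dots<r_{n-1}$; the rows $r_1,\dots,r_{n-1}$ form the identity matrix) whose column space is $X$; $\tau(X):\mathbb{F}_q^{n-1}\to X$ is the linear isomorphism sending $e_j$ to column $j$ of $M(X)$; and $\mu(X):\mathbb{C}[B_q(n-1)]\to\mathbb{C}[B_q(X)]$ is the linear map $Y\mapsto\tau(X)(Y)$.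 *)

theory Defs
  imports Complex_Main "HOL-Library.Function_Algebras" "HOL-Library.Cardinality" "HOL-Algebra.Group"
    "Jordan_Normal_Form.Matrix"
begin

text \<open>
  The field with q elements is an arbitrary finite field type \<open>'a\<close>, with q = \<open>CARD('a)\<close>.
  Column vectors are functions \<open>nat \<Rightarrow> 'a\<close> vanishing from some index on, so that the
  identification of \<open>F^k\<close> with a subspace of \<open>F^m\<close> for \<open>k < m\<close> is an inclusion of sets.
  Indices start at 0: the standard basis vector \<open>e_i\<close> of the mathematical text is
  \<open>unit_fun (i - 1)\<close>.
\<close>

definition fscale :: "'k::field \<Rightarrow> ('i \<Rightarrow> 'k) \<Rightarrow> ('i \<Rightarrow> 'k)" where
  "fscale c v = (\<lambda>i. c * v i)"

interpretation fn: vector_space "fscale :: 'k::field \<Rightarrow> ('i \<Rightarrow> 'k) \<Rightarrow> ('i \<Rightarrow> 'k)"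
  by unfold_locales (auto simp: fscale_def fun_eq_iff algebra_simps)

definition unit_fun :: "'i \<Rightarrow> 'i \<Rightarrow> 'k::field" where
  "unit_fun i = (\<lambda>j. if j = i then 1 else 0)"

definition linear_iso_on ::
  "('i \<Rightarrow> 'k::field) set \<Rightarrow> ('j \<Rightarrow> 'k) set \<Rightarrow> (('i \<Rightarrow> 'k) \<Rightarrow> ('j \<Rightarrow> 'k)) \<Rightarrow> bool" where
  "linear_iso_on V W f \<longleftrightarrow> fn.subspace V \<and> fn.subspace W \<and> bij_betw f V W \<and>
     (\<forall>u\<in>V. \<forall>v\<in>V. f (u + v) = f u + f v) \<and>
     (\<forall>c. \<forall>v\<in>V. f (fscale c v) = fscale c (f v))"

text \<open>
  For a finite set \<open>S\<close>, the space \<open>C[S]\<close> is \<open>free_space S\<close>, with the element \<open>s\<close> of its basis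
  represented by \<open>unit_fun s\<close>; \<open>lin_ext S f\<close> is the linear map on \<open>C[S]\<close> sending \<open>s\<close> to \<open>f s\<close>.
\<close>

definition free_space :: "'s set \<Rightarrow> ('s \<Rightarrow> complex) set" where
  "free_space S = {v. \<forall>s. s \<notin> S \<longrightarrow> v s = 0}"

definition lin_ext :: "'s set \<Rightarrow> ('s \<Rightarrow> 't \<Rightarrow> complex) \<Rightarrow> ('s \<Rightarrow> complex) \<Rightarrow> ('t \<Rightarrow> complex)" where
  "lin_ext S f v = (\<Sum>s\<in>S. fscale (v s) (f s))"

definition col_space :: "nat \<Rightarrow> (nat \<Rightarrow> 'a::field) set" where
  "col_space m = {v. \<forall>i\<ge>m. v i = 0}"

definition subspaces_of :: "(nat \<Rightarrow> 'a::field) set \<Rightarrow> (nat \<Rightarrow> 'a) set set" where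
  "subspaces_of X = {Z. fn.subspace Z \<and> Z \<subseteq> X}"

definition Bq :: "nat \<Rightarrow> (nat \<Rightarrow> 'a::field) set set" where
  "Bq m = subspaces_of (col_space m)"

definition covers :: "(nat \<Rightarrow> 'a::field) set \<Rightarrow> (nat \<Rightarrow> 'a) set \<Rightarrow> bool" where
  "covers Z' Z \<longleftrightarrow> Z \<subseteq> Z' \<and> fn.dim Z' = fn.dim Z + 1"

text \<open>
  The truncated subtraction in the exponent is harmless: for \<open>fn.dim Z = 0\<close> the sum that is
  scaled is empty.
\<close>

definition adj_op ::
  "nat \<Rightarrow> ((nat \<Rightarrow> 'a::{field,finite}) set \<Rightarrow> complex) \<Rightarrow> ((nat \<Rightarrow> 'a) set \<Rightarrow> complex)" where
  "adj_op m = lin_ext (Bq m) (\<lambda>Z.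
     (\<Sum>Z' | Z' \<in> Bq m \<and> covers Z' Z. unit_fun Z') +
     fscale (of_nat CARD('a) ^ (fn.dim Z - 1)) (\<Sum>Z' | Z' \<in> Bq m \<and> covers Z Z'. unit_fun Z'))"

text \<open>\<open>affine_part n\<close> is \<open>A_q(n+1)\<close>.\<close>

definition affine_part :: "nat \<Rightarrow> (nat \<Rightarrow> 'a::field) set set" where
  "affine_part n = {Y \<in> Bq (n + 1). \<not> Y \<subseteq> col_space n}"

definition hat :: "nat \<Rightarrow> (nat \<Rightarrow> 'a::field) set \<Rightarrow> (nat \<Rightarrow> 'a) set" where
  "hat n Z = fn.span (Z \<union> {unit_fun n})"

definition fun_of_vec :: "'a::field vec \<Rightarrow> (nat \<Rightarrow> 'a)" where
  "fun_of_vec v = (\<lambda>i. if i < dim_vec v then v $ i else 0)"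

definition mat_app :: "'a::field mat \<Rightarrow> (nat \<Rightarrow> 'a) \<Rightarrow> (nat \<Rightarrow> 'a)" where
  "mat_app g v = fun_of_vec (g *\<^sub>v vec (dim_col g) v)"

text \<open>\<open>Hgrp n\<close> is \<open>H(n+1, F_q)\<close>.\<close>

definition Hgrp :: "nat \<Rightarrow> 'a::field mat monoid" where
  "Hgrp n = \<lparr>carrier = {four_block_mat (1\<^sub>m n) a (0\<^sub>m 1 n) (1\<^sub>m 1) | a. a \<in> carrier_mat n 1},
             mult = (*), one = 1\<^sub>m (n + 1)\<rparr>"

lemma group_Hgrp: "group (Hgrp n :: 'a::field mat monoid)"
proof -
  let ?h = "\<lambda>a::'a mat. four_block_mat (1\<^sub>m n) a (0\<^sub>m 1 n) (1\<^sub>m 1)"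
  have mult: "?h a * ?h b = ?h (a + b)" if "a \<in> carrier_mat n 1" "b \<in> carrier_mat n 1" for a b
    using that by (subst mult_four_block_mat[of _ n n _ 1 _ 1 _ _ n _ 1])
      (auto simp: comm_add_mat[of b n 1 a])
  have one: "?h (0\<^sub>m n 1) = 1\<^sub>m (n + 1)"
    by (rule four_block_one_mat)
  have dim: "?h a \<in> carrier_mat (n + 1) (n + 1)" for a
    by (rule four_block_carrier_mat) auto
  show ?thesis
  proof (rule groupI, goal_cases)
    case (1 x y)
    then obtain a b where "x = ?h a" "y = ?h b" "a \<in> carrier_mat n 1" "b \<in> carrier_mat n 1"
      by (auto simp: Hgrp_def)
    then show ?case using mult[of a b] by (auto simp: Hgrp_def intro!: exI[of _ "a + b"])
  next
    case 2
    show ?case using one by (auto simp: Hgrp_def intro!: exI[of _ "0\<^sub>m n 1"])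
  next
    case (3 x y z)
    then have "x \<in> carrier_mat (n + 1) (n + 1)" "y \<in> carrier_mat (n + 1) (n + 1)"
      "z \<in> carrier_mat (n + 1) (n + 1)"
      using dim by (auto simp: Hgrp_def)
    then show ?case by (simp add: Hgrp_def assoc_mult_mat[of _ "n+1" "n+1" _ "n+1" _ "n+1"])
  next
    case (4 x)
    then have "x \<in> carrier_mat (n + 1) (n + 1)"
      using dim by (auto simp: Hgrp_def)
    then show ?case by (simp add: Hgrp_def)
  next
    case (5 x)
    then obtain a where a: "x = ?h a" "a \<in> carrier_mat n 1"
      by (auto simp: Hgrp_def)
    then have "?h (- a) * x = ?h (- a + a)"
      using mult[of "- a" a] by auto
    also have "\<dots> = 1\<^sub>m (n + 1)"
      using a one by (simp add: uminus_l_inv_mat)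
    finally show ?case
      using a uminus_carrier_iff_mat[of a n 1]
      by (intro bexI[of _ "?h (- a)"]) (auto simp: Hgrp_def)
  qed
qed

definition Cstar :: "complex monoid" where
  "Cstar = \<lparr>carrier = UNIV - {0}, mult = (*), one = 1\<rparr>"

definition nontriv_chars :: "nat \<Rightarrow> ('a::field mat \<Rightarrow> complex) set" where
  "nontriv_chars n = {chi \<in> hom (Hgrp n) Cstar. \<exists>g\<in>carrier (Hgrp n). chi g \<noteq> 1}"

definition Hact ::
  "nat \<Rightarrow> 'a::field mat \<Rightarrow> ((nat \<Rightarrow> 'a) set \<Rightarrow> complex) \<Rightarrow> ((nat \<Rightarrow> 'a) set \<Rightarrow> complex)" where
  "Hact n g = lin_ext (affine_part n) (\<lambda>Y. unit_fun (mat_app g ` Y))"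

definition char_proj :: "nat \<Rightarrow> ('a::field mat \<Rightarrow> complex) \<Rightarrow>
    ((nat \<Rightarrow> 'a) set \<Rightarrow> complex) \<Rightarrow> ((nat \<Rightarrow> 'a) set \<Rightarrow> complex)" where
  "char_proj n chi v = (\<Sum>g\<in>carrier (Hgrp n). fscale (cnj (chi g)) (Hact n g v))"

definition isotypic :: "nat \<Rightarrow> ('a::field mat \<Rightarrow> complex) \<Rightarrow> ((nat \<Rightarrow> 'a) set \<Rightarrow> complex) set" where
  "isotypic n chi = {v \<in> free_space (affine_part n).
     \<forall>g\<in>carrier (Hgrp n). Hact n g v = fscale (chi g) v}"

definition char_hyperplane :: "nat \<Rightarrow> ('a::field mat \<Rightarrow> complex) \<Rightarrow> (nat \<Rightarrow> 'a) set" where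
  "char_hyperplane n chi =
     (THE X. X \<in> Bq n \<and> fn.dim X = n - 1 \<and> char_proj n chi (unit_fun (hat n X)) \<noteq> 0)"

definition lambda_map :: "nat \<Rightarrow> ('a::{field,finite} mat \<Rightarrow> complex) \<Rightarrow>
    ((nat \<Rightarrow> 'a) set \<Rightarrow> complex) \<Rightarrow> ((nat \<Rightarrow> 'a) set \<Rightarrow> complex)" where
  "lambda_map n chi = lin_ext (subspaces_of (char_hyperplane n chi))
     (\<lambda>Y. fscale (1 / of_nat CARD('a) ^ fn.dim Y) (char_proj n chi (unit_fun (hat n Y))))"

text \<open>
  \<open>r j\<close> is the row of the last nonzero entry of column \<open>j\<close>; that this entry is 1 makes every
  column nonzero.
\<close>

definition schubert_nf :: "'a::field mat \<Rightarrow> bool" where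
  "schubert_nf M \<longleftrightarrow> (\<exists>r. strict_mono_on {..<dim_col M} r \<and>
     (\<forall>j<dim_col M. r j < dim_row M \<and> M $$ (r j, j) = 1 \<and>
        (\<forall>i<dim_row M. r j < i \<longrightarrow> M $$ (i, j) = 0)) \<and>
     (\<forall>k<dim_col M. \<forall>j<dim_col M. M $$ (r k, j) = (if k = j then 1 else 0)))"

definition schubert_mat :: "nat \<Rightarrow> (nat \<Rightarrow> 'a::field) set \<Rightarrow> 'a mat" where
  "schubert_mat n X = (THE M. M \<in> carrier_mat n (n - 1) \<and> schubert_nf M \<and>
     fn.span ((\<lambda>j. fun_of_vec (col M j)) ` {..<n - 1}) = X)"

definition tau :: "nat \<Rightarrow> (nat \<Rightarrow> 'a::field) set \<Rightarrow> (nat \<Rightarrow> 'a) \<Rightarrow> (nat \<Rightarrow> 'a)" where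
  "tau n X v = (\<Sum>j<n - 1. fscale (v j) (fun_of_vec (col (schubert_mat n X) j)))"

definition mu_map :: "nat \<Rightarrow> (nat \<Rightarrow> 'a::field) set \<Rightarrow>
    ((nat \<Rightarrow> 'a) set \<Rightarrow> complex) \<Rightarrow> ((nat \<Rightarrow> 'a) set \<Rightarrow> complex)" where
  "mu_map n X = lin_ext (Bq (n - 1)) (\<lambda>Y. unit_fun (tau n X ` Y))"

end

theory Submission imports Defs begin

text \<open>
  Every \<open>Y\<close> in \<open>A_q(n+1)\<close> is \<open>cone n Z a = g_a(hat Z)\<close> with \<open>Z = Y \<inter> F^n\<close> and \<open>a\<close> unique
  modulo \<open>Z\<close>, so a vector of \<open>W(\<chi>)\<close> is determined by its values at the \<open>hat Z\<close>, and these vanish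
  unless \<open>\<chi>\<close> is trivial on \<open>Z\<close>. The largest subspace on which \<open>\<chi>\<close> is trivial is a hyperplane,
  which is therefore \<open>X(\<chi>)\<close>. Hence \<open>\<lambda>(\<chi>)\<close> sends a function \<open>u\<close> on the subspaces of \<open>X(\<chi>)\<close> to
  the function \<open>lift u\<close> on \<open>A_q(n+1)\<close> with \<open>Y \<mapsto> u (Y \<inter> F^n) * khat Y\<close>, where \<open>khat Y\<close> averages the
  conjugate of \<open>\<chi>\<close> over the \<open>a\<close> with \<open>Y = g_a(hat Z)\<close>. A subspace in \<open>A_q(n+1)\<close> above \<open>Y\<close>
  is determined by its trace on \<open>F^n\<close>, whereas those below \<open>Y\<close> with a given trace partition the
  translates that make up \<open>Y\<close>; this produces the factor \<open>q\<close> of the intertwining relation. The sum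
  over all \<open>Y\<close> with trace \<open>Z\<close> is a full character sum, which removes the terms outside
  \<open>A_q(n+1)\<close>.
\<close>

section \<open>Finite subspaces\<close>

lemma sum_apply: "(\<Sum>s\<in>S. f s) t = (\<Sum>s\<in>S. f s t)"
  for f :: "'s \<Rightarrow> 't \<Rightarrow> 'b::comm_monoid_add"
  by (induction S rule: infinite_finite_induct) auto

lemma fscale_apply: "fscale c v i = c * v i"
  by (simp add: fscale_def)

lemma unit_fun_apply: "unit_fun s t = (if t = s then 1 else 0)"
  by (simp add: fscale_apply unit_fun_def)

lemma lin_ext_apply: "lin_ext S f v t = (\<Sum>s\<in>S. v s * f s t)"
  by (simp add: lin_ext_def sum_apply fscale_apply)

lemma finite_col_space [simp]: "finite (col_space m :: (nat \<Rightarrow> 'a::{field,finite}) set)"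
proof -
  have "finite {v :: nat \<Rightarrow> 'a. \<forall>i. (i \<in> {..<m} \<longrightarrow> v i \<in> UNIV) \<and> (i \<notin> {..<m} \<longrightarrow> v i = 0)}"
    by (rule finite_set_of_finite_funs) auto
  then show ?thesis
    by (simp add: col_space_def not_less)
qed

lemma subspace_col_space [simp]: "fn.subspace (col_space m)"
  by (auto simp: fn.subspace_def col_space_def fscale_apply)

lemma col_space_mono: "k \<le> m \<Longrightarrow> col_space k \<subseteq> col_space m"
  by (auto simp: col_space_def)

text \<open>Induction on \<open>B\<close>: for \<open>b\<close> outside the span of
  \<open>B\<close>, the map from \<open>(c, x)\<close> to \<open>c b + x\<close> is a bijection from
  the product of the field and that span onto the larger span.\<close>

lemma card_span_independent:
  fixes B :: "('i \<Rightarrow> 'a::{field,finite}) set"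
  assumes "finite B" "fn.independent B"
  shows "finite (fn.span B) \<and> card (fn.span B) = CARD('a) ^ card B"
  using assms
proof (induction B rule: finite_induct)
  case empty
  then show ?case by simp
next
  case (insert b B)
  then have b: "b \<notin> fn.span B" and B: "fn.independent B"
    using fn.independent_insert[of b B] by auto
  let ?f = "\<lambda>(c, x). fscale c b + x"
  have inj: "inj_on ?f (UNIV \<times> fn.span B)"
  proof (rule inj_onI, clarify)
    fix c x d y assume xy: "x \<in> fn.span B" "y \<in> fn.span B" and eq: "fscale c b + x = fscale d b + y"
    have "fscale (c - d) b = y - x"
      using eq by (simp add: fn.scale_left_diff_distrib algebra_simps)
    then have "fscale (c - d) b \<in> fn.span B"
      using xy fn.span_diff by metis
    then have "c = d"
      using b fn.span_scale[of "fscale (c - d) b" B "inverse (c - d)"] by (cases "c = d") auto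
    with eq show "c = d \<and> x = y" by auto
  qed
  have img: "fn.span (insert b B) = ?f ` (UNIV \<times> fn.span B)"
  proof (intro Set.set_eqI iffI)
    fix x assume "x \<in> fn.span (insert b B)"
    then obtain k where "x - fscale k b \<in> fn.span B"
      unfolding fn.span_insert by blast
    then show "x \<in> ?f ` (UNIV \<times> fn.span B)"
      by (intro image_eqI[of _ _ "(k, x - fscale k b)"]) auto
  next
    fix x assume "x \<in> ?f ` (UNIV \<times> fn.span B)"
    then obtain c y where "y \<in> fn.span B" "x = fscale c b + y"
      by auto
    then show "x \<in> fn.span (insert b B)"
      unfolding fn.span_insert by (auto intro!: exI[of _ c])
  qed
  show ?case
    using insert B inj by (simp add: img card_image card_cartesian_product)
qed

lemma card_subspace:
  fixes Z :: "('i \<Rightarrow> 'a::{field,finite}) set"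
  assumes "fn.subspace Z" "finite Z"
  shows "card Z = CARD('a) ^ fn.dim Z"
proof -
  obtain B where B: "B \<subseteq> Z" "fn.independent B" "Z \<subseteq> fn.span B" "card B = fn.dim Z"
    using fn.basis_exists by metis
  then have "fn.span B = Z"
    using assms fn.span_minimal by blast
  then show ?thesis
    using card_span_independent[of B] B assms finite_subset by metis
qed

lemma CARD_gt_1: "CARD('a::{field,finite}) > 1"
proof -
  have "card {0, 1 :: 'a} \<le> CARD('a)"
    by (rule card_mono) auto
  then show ?thesis by simp
qed

text \<open>Since q > 1, a power of q determines its exponent, so a condition on dimensions becomes
  one on cardinalities. Covering relations are checked by counting from here on.\<close>

lemma covers_iff_card:
  fixes Z Z' :: "(nat \<Rightarrow> 'a::{field,finite}) set"
  assumes "fn.subspace Z" "finite Z" "fn.subspace Z'" "finite Z'"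
  shows "covers Z' Z \<longleftrightarrow> Z \<subseteq> Z' \<and> card Z' = CARD('a) * card Z"
proof -
  have "CARD('a) ^ fn.dim Z' = CARD('a) ^ (fn.dim Z + 1) \<longleftrightarrow> fn.dim Z' = fn.dim Z + 1"
    using CARD_gt_1[where 'a = 'a] by (rule power_inject_exp)
  then show ?thesis
    by (simp add: covers_def card_subspace assms)
qed

lemma BqD:
  fixes Z :: "(nat \<Rightarrow> 'a::{field,finite}) set"
  assumes "Z \<in> Bq m"
  shows "fn.subspace Z" "Z \<subseteq> col_space m" "finite Z"
  using assms finite_subset[OF _ finite_col_space] by (auto simp: Bq_def subspaces_of_def)

lemma finite_subspaces_of: "finite X \<Longrightarrow> finite (subspaces_of X)"
  by (rule finite_subset[of _ "Pow X"]) (auto simp: subspaces_of_def)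

lemma finite_Bq [simp]: "finite (Bq m :: (nat \<Rightarrow> 'a::{field,finite}) set set)"
  by (simp add: Bq_def finite_subspaces_of)

lemma finite_affine_part [simp]: "finite (affine_part n :: (nat \<Rightarrow> 'a::{field,finite}) set set)"
  by (simp add: affine_part_def)

lemma unit_fun_in_col_space [simp]: "unit_fun i \<in> col_space m \<longleftrightarrow> i < m"
  by (auto simp: col_space_def unit_fun_def not_le)

lemma card_subspace_pos: "fn.subspace Z \<Longrightarrow> finite Z \<Longrightarrow> card Z > 0"
  using fn.subspace_0 card_gt_0_iff by blast

section \<open>Subspaces not contained in \<open>F^n\<close>\<close>

text \<open>The points of \<open>Y\<close> whose coordinate \<open>n\<close> is 1, moved into
  \<open>F^n\<close>. For \<open>Y\<close> in \<open>affine_part n\<close> these are the possible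
  translation vectors \<open>a\<close> of the subspace \<open>Y\<close>.\<close>

definition slice :: "nat \<Rightarrow> (nat \<Rightarrow> 'a::field) set \<Rightarrow> (nat \<Rightarrow> 'a) set" where
  "slice n Y = {a \<in> col_space n. unit_fun n + a \<in> Y}"

text \<open>The span of \<open>Z\<close> and \<open>unit_fun n + a\<close>, written as a membership
  test: for \<open>Z\<close> and \<open>a\<close> in \<open>F^n\<close> the coefficient of
  \<open>unit_fun n + a\<close> in \<open>w\<close> can only be \<open>w n\<close>.\<close>

definition cone :: "nat \<Rightarrow> (nat \<Rightarrow> 'a::field) set \<Rightarrow> (nat \<Rightarrow> 'a) \<Rightarrow> (nat \<Rightarrow> 'a) set" where
  "cone n Z a = {w. w - fscale (w n) (unit_fun n + a) \<in> Z}"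

lemma hat_eq_cone:
  assumes "Z \<in> Bq n" shows "hat n Z = cone n Z 0"
proof -
  have Z: "fn.subspace Z" "\<And>z. z \<in> Z \<Longrightarrow> z n = 0"
    using assms by (auto simp: Bq_def subspaces_of_def col_space_def)
  have "w - fscale k (unit_fun n) \<in> Z \<Longrightarrow> k = w n" for w and k :: 'a
    using Z(2)[of "w - fscale k (unit_fun n)"] by (simp add: fscale_apply unit_fun_def)
  moreover have span: "fn.span Z = Z"
    using Z by simp
  ultimately show ?thesis
    unfolding hat_def cone_def Un_insert_right Un_empty_right fn.span_insert span
    by auto
qed

lemma cone_in_affine_part:
  assumes Z: "Z \<in> Bq n" and a: "a \<in> col_space n"
  shows "cone n Z a \<in> affine_part n" "cone n Z a \<inter> col_space n = Z"
proof -
  have sZ: "fn.subspace Z" and Zn: "\<And>z i. z \<in> Z \<Longrightarrow> i \<ge> n \<Longrightarrow> z i = 0"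
    using Z by (auto simp: Bq_def subspaces_of_def col_space_def)
  have an: "\<And>i. i \<ge> n \<Longrightarrow> a i = 0"
    using a by (auto simp: col_space_def)
  have "cone n Z a \<subseteq> col_space (n + 1)"
  proof
    fix w assume "w \<in> cone n Z a"
    then have "w i = 0" if "i \<ge> n + 1" for i
      using that an[of i] Zn[of "w - fscale (w n) (unit_fun n + a)" i]
      by (simp add: cone_def fscale_apply unit_fun_def)
    then show "w \<in> col_space (n + 1)"
      by (simp add: col_space_def)
  qed
  moreover have "fn.subspace (cone n Z a)"
    unfolding fn.subspace_def
  proof (intro conjI ballI allI)
    show "0 \<in> cone n Z a"
      using fn.subspace_0[OF sZ] by (simp add: cone_def)
  next
    fix x y assume "x \<in> cone n Z a" "y \<in> cone n Z a"
    then show "x + y \<in> cone n Z a"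
      using fn.subspace_add[OF sZ, of "x - fscale (x n) (unit_fun n + a)" "y - fscale (y n) (unit_fun n + a)"]
      by (simp add: cone_def fn.scale_left_distrib add_diff_add)
  next
    fix c x assume "x \<in> cone n Z a"
    then show "fscale c x \<in> cone n Z a"
      using fn.subspace_scale[OF sZ, of "x - fscale (x n) (unit_fun n + a)" c]
      by (simp add: cone_def fscale_apply fn.scale_right_diff_distrib)
  qed
  \<comment> \<open>The new generator has coordinate \<open>n\<close> equal to 1, so it witnesses
    that the cone is not contained in \<open>F^n\<close>.\<close>
  moreover have "unit_fun n + a \<in> cone n Z a" "unit_fun n + a \<notin> col_space n"
    using fn.subspace_0[OF sZ] an by (auto simp: cone_def unit_fun_def col_space_def)
  ultimately show "cone n Z a \<in> affine_part n"
    by (auto simp: affine_part_def Bq_def subspaces_of_def)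
  have "w \<in> cone n Z a \<longleftrightarrow> w \<in> Z" if "w n = 0" for w
    using that by (simp add: cone_def)
  moreover have "Z \<subseteq> col_space n"
    using Z by (simp add: Bq_def subspaces_of_def)
  ultimately show "cone n Z a \<inter> col_space n = Z"
    by (auto simp: col_space_def)
qed

lemma slice_cone:
  assumes Z: "Z \<in> Bq n" and a: "a \<in> col_space n"
  shows "b \<in> slice n (cone n Z a) \<longleftrightarrow> b \<in> col_space n \<and> b - a \<in> Z"
proof -
  have "fscale (1::'a) x = x" for x :: "nat \<Rightarrow> 'a" by (fact fn.scale_one)
  then show ?thesis
    by (auto simp: slice_def cone_def unit_fun_apply[of n n] fscale_apply col_space_def)
qed

lemma affine_partD:
  fixes Y :: "(nat \<Rightarrow> 'a::{field,finite}) set"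
  assumes "Y \<in> affine_part n"
  shows "fn.subspace Y" "Y \<subseteq> col_space (n + 1)" "finite Y" "Y \<in> Bq (n + 1)"
    "Y \<inter> col_space n \<in> Bq n" "slice n Y \<noteq> {}"
proof -
  show Y: "fn.subspace Y" "Y \<subseteq> col_space (n + 1)" "finite Y" "Y \<in> Bq (n + 1)"
    using assms BqD[of Y "n + 1"] by (auto simp: affine_part_def)
  then show "Y \<inter> col_space n \<in> Bq n"
    by (simp add: Bq_def subspaces_of_def fn.subspace_inter)
  obtain w where w: "w \<in> Y" "w \<notin> col_space n"
    using assms by (auto simp: affine_part_def)
  have wn: "w n \<noteq> 0"
  proof
    assume "w n = 0"
    then have "w i = 0" if "i \<ge> n" for i
      using that w(1) Y(2) by (cases "i = n") (auto simp: col_space_def)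
    with w(2) show False
      by (simp add: col_space_def)
  qed
  \<comment> \<open>Rescale \<open>w\<close> so that its coordinate \<open>n\<close> becomes 1 and
    remove \<open>unit_fun n\<close>; this gives an element of the slice.\<close>
  let ?a = "fscale (1 / w n) w - unit_fun n"
  have "w i = 0" if "i > n" for i
    using w(1) Y(2) that by (auto simp: col_space_def)
  then have "?a \<in> col_space n"
    using wn by (auto simp: col_space_def fscale_apply unit_fun_def)
  moreover have "unit_fun n + ?a \<in> Y"
    using w Y fn.subspace_scale by simp
  ultimately show "slice n Y \<noteq> {}"
    unfolding slice_def by blast
qed

text \<open>Subtracting a multiple of \<open>unit_fun n + a\<close>, itself in \<open>Y\<close>,
  does not affect membership in \<open>Y\<close>, and with coefficient \<open>w n\<close> it moves
  the vectors of \<open>Y\<close> into \<open>F^n\<close>.\<close>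

lemma cone_slice:
  fixes Y :: "(nat \<Rightarrow> 'a::{field,finite}) set"
  assumes Y: "Y \<in> affine_part n" and a: "a \<in> slice n Y"
  shows "cone n (Y \<inter> col_space n) a = Y"
proof (rule Set.set_eqI)
  fix w
  have sY: "fn.subspace Y" and sub: "Y \<subseteq> col_space (n + 1)"
    using affine_partD[OF Y] by auto
  have a': "fscale (w n) (unit_fun n + a) \<in> Y" and an: "\<And>i. i \<ge> n \<Longrightarrow> a i = 0"
    using a fn.subspace_scale[OF sY] by (auto simp: slice_def col_space_def)
  have *: "w - fscale (w n) (unit_fun n + a) \<in> Y \<longleftrightarrow> w \<in> Y"
    using a' fn.subspace_diff[OF sY] fn.subspace_add[OF sY]
    by (metis diff_add_cancel)
  have "w - fscale (w n) (unit_fun n + a) \<in> col_space n" if "w \<in> Y"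
  proof -
    have "w i = 0" if "i > n" for i
      using \<open>w \<in> Y\<close> sub that by (auto simp: col_space_def)
    then show ?thesis
      using an by (auto simp: col_space_def fscale_apply unit_fun_def)
  qed
  then show "w \<in> cone n (Y \<inter> col_space n) a \<longleftrightarrow> w \<in> Y"
    using * by (auto simp: cone_def)
qed

text \<open>The freedom in the parametrisation by cones: the trace is determined, and
  \<open>a\<close> may be any point of the slice. This identifies the fibres of
  \<open>cone n Z\<close>.\<close>

lemma cone_eq_iff:
  fixes Y :: "(nat \<Rightarrow> 'a::{field,finite}) set"
  assumes "Z \<in> Bq n" "a \<in> col_space n" "Y \<in> affine_part n"
  shows "cone n Z a = Y \<longleftrightarrow> Y \<inter> col_space n = Z \<and> a \<in> slice n Y"
proof
  assume "cone n Z a = Y"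
  then show "Y \<inter> col_space n = Z \<and> a \<in> slice n Y"
    using assms cone_in_affine_part(2)[of Z n a] slice_cone[of Z n a a] fn.subspace_0[of Z] BqD(1)
    by auto
next
  assume "Y \<inter> col_space n = Z \<and> a \<in> slice n Y"
  then show "cone n Z a = Y"
    using cone_slice[of Y n a] assms by blast
qed

text \<open>With \<open>Y\<close> written as the cone over its trace at \<open>a\<close>,
  \<open>slice_cone\<close> describes the slice as the coset of the trace through
  \<open>a\<close>.\<close>

lemma slice_eq_translate:
  fixes Y :: "(nat \<Rightarrow> 'a::{field,finite}) set"
  assumes Y: "Y \<in> affine_part n" and a: "a \<in> slice n Y"
  shows "slice n Y = (\<lambda>z. a + z) ` (Y \<inter> col_space n)"
proof -
  have aV: "a \<in> col_space n"
    using a by (simp add: slice_def)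
  have "b \<in> slice n Y \<longleftrightarrow> b \<in> col_space n \<and> b - a \<in> Y \<inter> col_space n" for b
    using slice_cone[OF affine_partD(5)[OF Y] aV] cone_slice[OF Y a] by auto
  moreover have "b \<in> col_space n" if "b - a \<in> col_space n" for b
    using fn.subspace_add[OF subspace_col_space that aV] by simp
  ultimately have "b \<in> slice n Y \<longleftrightarrow> b - a \<in> Y \<inter> col_space n" for b
    by blast
  moreover have "b \<in> (\<lambda>z. a + z) ` T \<longleftrightarrow> b - a \<in> T" for b T
    by (auto intro!: image_eqI[of _ _ "b - a"])
  ultimately show ?thesis
    by (intro Set.set_eqI) simp
qed

lemma card_slice:
  fixes Y :: "(nat \<Rightarrow> 'a::{field,finite}) set"
  assumes "Y \<in> affine_part n"
  shows "card (slice n Y) = card (Y \<inter> col_space n)"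
proof -
  obtain a where "a \<in> slice n Y"
    using affine_partD(6)[OF assms] by blast
  then show ?thesis
    using slice_eq_translate[OF assms] by (metis card_image inj_on_add)
qed

text \<open>A vector of \<open>Y\<close> splits into its coordinate \<open>n\<close>, which is
  arbitrary, and its remainder along \<open>unit_fun n + a\<close>, which ranges over the
  trace.\<close>

lemma card_affine_part:
  fixes Y :: "(nat \<Rightarrow> 'a::{field,finite}) set"
  assumes Y: "Y \<in> affine_part n"
  shows "card Y = CARD('a) * card (Y \<inter> col_space n)"
proof -
  obtain a where a: "a \<in> slice n Y"
    using affine_partD(6)[OF assms] by blast
  let ?g = "\<lambda>w. (w n, w - fscale (w n) (unit_fun n + a))"
  let ?f = "\<lambda>(c, z). z + fscale c (unit_fun n + a)"
  have mem: "w \<in> Y \<longleftrightarrow> w - fscale (w n) (unit_fun n + a) \<in> Y \<inter> col_space n" for w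
  proof -
    have "w \<in> cone n (Y \<inter> col_space n) a
      \<longleftrightarrow> w - fscale (w n) (unit_fun n + a) \<in> Y \<inter> col_space n"
      by (simp add: cone_def)
    then show ?thesis
      unfolding cone_slice[OF Y a] .
  qed
  have coord: "(z + fscale c (unit_fun n + a)) n = c" if "z \<in> col_space n" for z c
    using that a by (simp add: slice_def col_space_def fscale_apply unit_fun_apply)
  have "bij_betw ?g Y (UNIV \<times> (Y \<inter> col_space n))"
  proof (rule bij_betw_byWitness[where f' = ?f])
    show "\<forall>w\<in>Y. ?f (?g w) = w"
      by simp
    show "\<forall>p\<in>UNIV \<times> (Y \<inter> col_space n). ?g (?f p) = p"
      using coord by (clarsimp simp del: plus_fun_apply)
    show "?g ` Y \<subseteq> UNIV \<times> (Y \<inter> col_space n)"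
    proof (rule image_subsetI)
      fix w assume "w \<in> Y"
      then show "?g w \<in> UNIV \<times> (Y \<inter> col_space n)"
        using mem[of w] by (simp only: mem_Times_iff fst_conv snd_conv UNIV_I simp_thms)
    qed
    show "?f ` (UNIV \<times> (Y \<inter> col_space n)) \<subseteq> Y"
    proof (rule image_subsetI, clarify)
      fix c z assume z: "z \<in> Y" "z \<in> col_space n"
      have "z + fscale c (unit_fun n + a) - fscale c (unit_fun n + a) \<in> Y \<inter> col_space n"
        using z by simp
      then show "z + fscale c (unit_fun n + a) \<in> Y"
        using mem[of "z + fscale c (unit_fun n + a)"] coord[OF z(2), of c] by metis
    qed
  qed
  then show ?thesis
    by (simp add: bij_betw_same_card card_cartesian_product)
qed

section \<open>Schubert normal form of a hyperplane\<close>

text \<open>The coefficients of a combination of the \<open>C j\<close> are its pivot coordinates.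
  The vectors rebuilt from their pivot coordinates form a subspace containing every
  \<open>C j\<close>, which gives a membership test for the span.\<close>

lemma span_pivoted:
  fixes C :: "nat \<Rightarrow> 'i \<Rightarrow> 'a::field"
  assumes piv: "\<And>j k. j < m \<Longrightarrow> k < m \<Longrightarrow> C j (r k) = (if k = j then 1 else 0)"
  shows "fn.span (C ` {..<m}) = {x. x = (\<Sum>j<m. fscale (x (r j)) (C j))}"
proof (intro subset_antisym fn.span_minimal)
  show "C ` {..<m} \<subseteq> {x. x = (\<Sum>j<m. fscale (x (r j)) (C j))}"
  proof (intro image_subsetI CollectI)
    fix k assume k: "k \<in> {..<m}"
    have "(\<Sum>j<m. fscale (C k (r j)) (C j)) = (\<Sum>j<m. if j = k then C k else 0)"
      using piv k by (intro sum.cong refl) auto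
    then show "C k = (\<Sum>j<m. fscale (C k (r j)) (C j))"
      using k by simp
  qed
  show "fn.subspace {x. x = (\<Sum>j<m. fscale (x (r j)) (C j))}"
    unfolding fn.subspace_def mem_Collect_eq
  proof (intro conjI ballI allI)
    fix x y assume "x \<in> {x. x = (\<Sum>j<m. fscale (x (r j)) (C j))}"
      "y \<in> {x. x = (\<Sum>j<m. fscale (x (r j)) (C j))}"
    then have "x + y = (\<Sum>j<m. fscale (x (r j)) (C j)) + (\<Sum>j<m. fscale (y (r j)) (C j))"
      by simp
    also have "\<dots> = (\<Sum>j<m. fscale ((x + y) (r j)) (C j))"
      by (simp add: fn.scale_left_distrib sum.distrib)
    finally show "x + y = (\<Sum>j<m. fscale ((x + y) (r j)) (C j))" .
  next
    fix c x assume "x \<in> {x. x = (\<Sum>j<m. fscale (x (r j)) (C j))}"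
    then have "fscale c x = fscale c (\<Sum>j<m. fscale (x (r j)) (C j))"
      by simp
    also have "\<dots> = (\<Sum>j<m. fscale (fscale c x (r j)) (C j))"
      by (simp add: fn.scale_sum_right fscale_apply[of c x])
    finally show "fscale c x = (\<Sum>j<m. fscale (fscale c x (r j)) (C j))" .
  qed simp
  show "{x. x = (\<Sum>j<m. fscale (x (r j)) (C j))} \<subseteq> fn.span (C ` {..<m})"
  proof
    fix x assume "x \<in> {x. x = (\<Sum>j<m. fscale (x (r j)) (C j))}"
    then have "x = (\<Sum>j<m. fscale (x (r j)) (C j))" by simp
    also have "\<dots> \<in> fn.span (C ` {..<m})"
      by (intro fn.span_sum fn.span_scale fn.span_base) auto
    finally show "x \<in> fn.span (C ` {..<m})" .
  qed
qed

text \<open>Increasing enumeration of the indices other than \<open>s\<close>: the pivot rows of a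
  hyperplane in Schubert normal form, where exactly one row \<open>s\<close> is missing.\<close>

definition skip :: "nat \<Rightarrow> nat \<Rightarrow> nat" where
  "skip s j = (if j < s then j else Suc j)"

lemma skip_neq [simp]: "skip s j \<noteq> s" "s \<noteq> skip s j"
  by (auto simp: skip_def)

lemma skip_eq_iff [simp]: "skip s j = skip s k \<longleftrightarrow> j = k"
  by (auto simp: skip_def)

lemma skip_surj:
  assumes "i \<noteq> s" "i < n" "s < n"
  obtains j where "j < n - 1" "i = skip s j"
proof (cases "i < s")
  case True
  then show ?thesis using that[of i] assms by (simp add: skip_def)
next
  case False
  then show ?thesis using that[of "i - 1"] assms by (auto simp: skip_def)
qed

text \<open>Strict growth and the bound leave only \<open>j\<close> or \<open>Suc j\<close> for
  \<open>r j\<close>, and after the first jump all later values are shifted as well.\<close>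

lemma strict_mono_on_eq_skip:
  assumes mono: "strict_mono_on {..<m} r" and bound: "\<And>j. j < m \<Longrightarrow> r j \<le> m"
  obtains s where "s \<le> m" "\<And>j. j < m \<Longrightarrow> r j = skip s j"
proof -
  have grow: "r i + (j - i) \<le> r j" if "i \<le> j" "j < m" for i j
    using that
  proof (induction j rule: dec_induct)
    case (step k)
    have "r k < r (Suc k)"
      using mono step.prems by (auto simp: strict_mono_on_def)
    then show ?case using step by simp
  qed simp
  have range: "r j = j \<or> r j = Suc j" if "j < m" for j
    using grow[of 0 j] grow[of j "m - 1"] bound[of "m - 1"] that by linarith
  \<comment> \<open>The position of the first jump; the alternative \<open>j \<ge> m\<close> makes
    \<open>s = m\<close> when there is none.\<close>
  define s where "s = (LEAST j. j \<ge> m \<or> r j = Suc j)"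
  have s: "s \<ge> m \<or> r s = Suc s"
    unfolding s_def by (rule LeastI[of _ m]) simp
  have least: "j < m" "r j \<noteq> Suc j" if "j < s" for j
    using not_less_Least[of j "\<lambda>j. j \<ge> m \<or> r j = Suc j"] that by (auto simp: s_def)
  show thesis
  proof
    show "s \<le> m"
      using least(1)[of m] by (meson not_le less_irrefl)
    fix j assume j: "j < m"
    show "r j = skip s j"
    proof (cases "j < s")
      case True
      then show ?thesis using least range[OF j] by (auto simp: skip_def)
    next
      case False
      then have "Suc j \<le> r j"
        using grow[of s j] s j by auto
      then show ?thesis
        using range[OF j] False by (auto simp: skip_def)
    qed
  qed
qed

text \<open>The span determines the missing row, by \<open>not_less\<close> below. Once the pivot
  rows agree, columns with the same index differ by a vector of the span that is 0 at all pivots,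
  hence by 0.\<close>

lemma schubert_unique:
  fixes M M' :: "'a::field mat"
  assumes n: "n \<ge> 1" and M: "M \<in> carrier_mat n (n - 1)" "schubert_nf M"
    and M': "M' \<in> carrier_mat n (n - 1)" "schubert_nf M'"
    and span: "fn.span ((\<lambda>j. fun_of_vec (col M j)) ` {..<n - 1})
      = fn.span ((\<lambda>j. fun_of_vec (col M' j)) ` {..<n - 1})"
  shows "M = M'"
proof -
  define col' where "col' N j = fun_of_vec (col N j)" for N :: "'a mat" and j
  have col'_index: "col' N j i = (if i < n then N $$ (i, j) else 0)"
    if "N \<in> carrier_mat n (n - 1)" "j < n - 1" for N i j
    using that by (auto simp: col'_def fun_of_vec_def)
  have pivots: "\<exists>s<n. (\<forall>k<n - 1. \<forall>j<n - 1. col' N j (skip s k) = (if k = j then 1 else 0)) \<and>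
      (\<forall>j<n - 1. skip s j < s \<longrightarrow> col' N j s = 0)"
    if N: "N \<in> carrier_mat n (n - 1)" "schubert_nf N" for N
  proof -
    from N obtain r where r: "strict_mono_on {..<n - 1} r" "\<And>j. j < n - 1 \<Longrightarrow> r j < n"
        "\<And>j i. j < n - 1 \<Longrightarrow> i < n \<Longrightarrow> r j < i \<Longrightarrow> N $$ (i, j) = 0"
        "\<And>k j. k < n - 1 \<Longrightarrow> j < n - 1 \<Longrightarrow> N $$ (r k, j) = (if k = j then 1 else 0)"
      unfolding schubert_nf_def by auto
    have "r j \<le> n - 1" if "j < n - 1" for j
      using r(2)[OF that] by simp
    with r(1) obtain s where s: "s \<le> n - 1" "\<And>j. j < n - 1 \<Longrightarrow> r j = skip s j"
      by (rule strict_mono_on_eq_skip) blast+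
    have "s < n" using s(1) n by simp
    moreover have "col' N j (skip s k) = (if k = j then 1 else 0)" if "k < n - 1" "j < n - 1" for k j
      using r(2)[of k] r(4)[of k j] s(2)[of k] that by (simp add: col'_index[OF N(1)])
    moreover have "col' N j s = 0" if "j < n - 1" "skip s j < s" for j
      using r(3)[of j s] s(2)[of j] that \<open>s < n\<close> by (simp add: col'_index[OF N(1)])
    ultimately show ?thesis by blast
  qed
  have zero: "x = 0"
    if "N \<in> carrier_mat n (n - 1)" "x \<in> fn.span (col' N ` {..<n - 1})"
      "\<forall>k<n - 1. \<forall>j<n - 1. col' N j (skip s k) = (if k = j then 1 else 0)"
      "\<And>k. k < n - 1 \<Longrightarrow> x (skip s k) = 0" for N x s
  proof -
    have "x = (\<Sum>j<n - 1. fscale (x (skip s j)) (col' N j))"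
      using that(2,3) span_pivoted[where C = "col' N" and r = "skip s" and m = "n - 1"] by auto
    also have "\<dots> = 0"
      using that(4) by (intro sum.neutral) simp
    finally show ?thesis .
  qed
  \<comment> \<open>If \<open>s < s'\<close>, column \<open>s\<close> of \<open>N'\<close> has its
    pivot in row \<open>s\<close> and is 0 in the other pivot rows and in row \<open>s'\<close>, so
    it equals \<open>unit_fun s\<close>. In the span of the columns of \<open>N\<close> it is 0 at
    all pivot rows of \<open>N\<close>, which miss \<open>s\<close>, and would have to
    vanish.\<close>
  have not_less: "\<not> s < s'"
    if N: "N \<in> carrier_mat n (n - 1)" and N': "N' \<in> carrier_mat n (n - 1)"
      and span: "fn.span (col' N ` {..<n - 1}) = fn.span (col' N' ` {..<n - 1})"
      and s: "\<forall>k<n - 1. \<forall>j<n - 1. col' N j (skip s k) = (if k = j then 1 else 0)"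
      and s': "s' < n" "\<forall>k<n - 1. \<forall>j<n - 1. col' N' j (skip s' k) = (if k = j then 1 else 0)"
        "\<forall>j<n - 1. skip s' j < s' \<longrightarrow> col' N' j s' = 0"
    for N N' s s'
  proof
    assume less: "s < s'"
    then have sn: "s < n - 1" and skip: "skip s' s = s"
      using s'(1) by (auto simp: skip_def)
    have eq: "col' N' s = unit_fun s"
    proof
      fix i
      consider "i \<ge> n" | "i = s'" | k where "k < n - 1" "i = skip s' k"
        using skip_surj[of i s' n] s'(1) not_le by blast
      then show "col' N' s i = unit_fun s i"
      proof cases
        case 1
        then show ?thesis using sn by (simp add: col'_index[OF N'] unit_fun_apply)
      next
        case 2
        then show ?thesis using s'(3) sn skip less by (simp add: unit_fun_apply)
      next
        case 3
        then have "skip s' k = s \<longleftrightarrow> k = s"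
          using skip skip_eq_iff[of s' k s] by simp
        then show ?thesis using 3 s'(2) sn by (simp add: unit_fun_apply)
      qed
    qed
    have "col' N' s \<in> fn.span (col' N' ` {..<n - 1})"
      using sn by (intro fn.span_base) simp
    then have "unit_fun s \<in> fn.span (col' N ` {..<n - 1})"
      unfolding eq span .
    then have "unit_fun s = (0 :: nat \<Rightarrow> 'a)"
      by (rule zero[OF N _ s]) (simp add: unit_fun_apply)
    then have "unit_fun s s = (0 :: 'a)"
      by simp
    then show False
      by (simp add: unit_fun_apply)
  qed
  have span': "fn.span (col' M ` {..<n - 1}) = fn.span (col' M' ` {..<n - 1})"
    using span by (simp add: col'_def[abs_def])
  obtain s where s: "s < n" "\<forall>k<n - 1. \<forall>j<n - 1. col' M j (skip s k) = (if k = j then 1 else 0)"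
      "\<forall>j<n - 1. skip s j < s \<longrightarrow> col' M j s = 0"
    using pivots[OF M] by blast
  obtain s' where s': "s' < n" "\<forall>k<n - 1. \<forall>j<n - 1. col' M' j (skip s' k) = (if k = j then 1 else 0)"
      "\<forall>j<n - 1. skip s' j < s' \<longrightarrow> col' M' j s' = 0"
    using pivots[OF M'] by blast
  have "s = s'"
    using not_less[OF M(1) M'(1) span' s(2) s'] not_less[OF M'(1) M(1) span'[symmetric] s'(2) s]
    by simp
  have eq: "col' M j = col' M' j" if j: "j < n - 1" for j
  proof -
    have "col' M j - col' M' j \<in> fn.span (col' M ` {..<n - 1})"
    proof (rule fn.span_diff)
      show "col' M j \<in> fn.span (col' M ` {..<n - 1})"
        using j by (intro fn.span_base) simp
      show "col' M' j \<in> fn.span (col' M ` {..<n - 1})"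
        unfolding span' using j by (intro fn.span_base) simp
    qed
    then have "col' M j - col' M' j = 0"
      using s(2) s'(2) j \<open>s = s'\<close> by (intro zero[OF M(1) _ s(2)]) simp_all
    then show ?thesis by simp
  qed
  show "M = M'"
  proof (intro eq_matI)
    fix i j assume ij: "i < dim_row M'" "j < dim_col M'"
    then have "i < n" "j < n - 1" using M' by auto
    then show "M $$ (i, j) = M' $$ (i, j)"
      using fun_cong[OF eq, of j i] col'_index[OF M(1)] col'_index[OF M'(1)] by simp
  qed (use M M' in auto)
qed

lemma unit_fun_expansion:
  assumes "v \<in> col_space n"
  shows "v = (\<Sum>i<n. fscale (v i) (unit_fun i))"
proof
  fix j
  have "(\<Sum>i<n. fscale (v i) (unit_fun i)) j = (\<Sum>i<n. if i = j then v i else 0)"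
    unfolding sum_apply by (intro sum.cong refl) (simp add: fscale_apply unit_fun_apply)
  then show "v j = (\<Sum>i<n. fscale (v i) (unit_fun i)) j"
    using assms by (auto simp: col_space_def)
qed

text \<open>The assumption \<open>hyp\<close> expresses codimension one without dimensions, in the
  form that \<open>ker_complement\<close> supplies. Each column is a unit vector corrected by a
  multiple of the first unit vector outside \<open>X\<close>, so that it falls into
  \<open>X\<close>.\<close>

lemma schubert_exists:
  fixes X :: "(nat \<Rightarrow> 'a::field) set"
  assumes X: "fn.subspace X" "X \<subseteq> col_space n" "X \<noteq> col_space n"
    and hyp: "\<And>v w. v \<in> col_space n \<Longrightarrow> v \<notin> X \<Longrightarrow> w \<in> col_space n \<Longrightarrow> \<exists>c. w - fscale c v \<in> X"
  shows "\<exists>M. M \<in> carrier_mat n (n - 1) \<and> schubert_nf M \<and>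
    fn.span ((\<lambda>j. fun_of_vec (col M j)) ` {..<n - 1}) = X"
proof -
  have ex: "\<exists>i. i < n \<and> unit_fun i \<notin> X"
  proof (rule ccontr)
    assume "\<not> ?thesis"
    then have "v \<in> X" if "v \<in> col_space n" for v
      by (subst unit_fun_expansion[OF that])
        (intro fn.subspace_sum[OF X(1)] fn.subspace_scale[OF X(1)], auto)
    then show False using X by blast
  qed
  define s where "s = (LEAST i. i < n \<and> unit_fun i \<notin> X)"
  have s: "s < n" "unit_fun s \<notin> X"
    using LeastI_ex[OF ex] by (auto simp: s_def)
  have below: "unit_fun i \<in> X" if "i < s" for i
    using not_less_Least[of i "\<lambda>i. i < n \<and> unit_fun i \<notin> X"] that s by (auto simp: s_def)
  \<comment> \<open>Taking \<open>d = 0\<close> for \<open>i < s\<close> keeps row \<open>s\<close>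
    zero in the columns whose pivot row comes before \<open>s\<close>, so that the pivot is their
    last nonzero entry.\<close>
  have "\<exists>d. unit_fun i - fscale d (unit_fun s) \<in> X \<and> (i < s \<longrightarrow> d = 0)" if "i < n" for i
  proof (cases "i < s")
    case True
    then show ?thesis using below by (intro exI[of _ 0]) simp
  next
    case False
    then show ?thesis using hyp[of "unit_fun s" "unit_fun i"] s that by auto
  qed
  then obtain d where d: "\<And>i. i < n \<Longrightarrow> unit_fun i - fscale (d i) (unit_fun s) \<in> X"
      "\<And>i. i < n \<Longrightarrow> i < s \<Longrightarrow> d i = 0"
    by metis
  define C where "C j = unit_fun (skip s j) - fscale (d (skip s j)) (unit_fun s)" for j
  have skip_less: "skip s j < n" if "j < n - 1" for j
    using that s by (auto simp: skip_def)
  have CX: "C j \<in> X" if "j < n - 1" for j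
    using d(1)[OF skip_less[OF that]] by (simp add: C_def)
  have piv: "C j (skip s k) = (if k = j then 1 else 0)" for j k
    by (auto simp: C_def fscale_apply unit_fun_apply)
  have C_above: "C j i = 0" if "j < n - 1" "skip s j < i" for j i
    using that d(2)[OF skip_less] by (auto simp: C_def fscale_apply unit_fun_apply)
  let ?M = "mat n (n - 1) (\<lambda>(i, j). C j i)"
  have col: "fun_of_vec (col ?M j) = C j" if "j < n - 1" for j
    using that C_above[OF that] skip_less[OF that]
    by (auto simp: fun_of_vec_def fun_eq_iff)
  have "schubert_nf ?M"
    unfolding schubert_nf_def
    by (rule exI[of _ "skip s"])
      (auto simp: skip_less piv C_above strict_mono_on_def, auto simp: skip_def)
  moreover have "fn.span (C ` {..<n - 1}) = X"
  proof (intro subset_antisym fn.span_minimal X(1))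
    show "X \<subseteq> fn.span (C ` {..<n - 1})"
    proof
      fix x assume x: "x \<in> X"
      \<comment> \<open>Clearing the pivot coordinates of \<open>x\<close> leaves a multiple of
        \<open>unit_fun s\<close> inside \<open>X\<close>, which must be 0 because
        \<open>unit_fun s\<close> is not in \<open>X\<close>.\<close>
      define y where "y = x - (\<Sum>j<n - 1. fscale (x (skip s j)) (C j))"
      have yX: "y \<in> X"
        unfolding y_def
        by (intro fn.subspace_diff[OF X(1) x] fn.subspace_sum[OF X(1)] fn.subspace_scale[OF X(1)] CX)
          simp
      have y_skip: "y (skip s k) = 0" if "k < n - 1" for k
      proof -
        have "(\<Sum>j<n - 1. fscale (x (skip s j)) (C j)) (skip s k)
            = (\<Sum>j<n - 1. if j = k then x (skip s j) else 0)"
          unfolding sum_apply by (intro sum.cong refl) (simp add: fscale_apply piv)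
        then show ?thesis
          using that by (simp add: y_def)
      qed
      have "y i = 0" if neq: "i \<noteq> s" for i
      proof (cases "i < n")
        case True
        then obtain k where "k < n - 1" "i = skip s k"
          using skip_surj[OF neq _ s(1)] by blast
        then show ?thesis using y_skip by simp
      next
        case False
        then show ?thesis using yX X(2) by (auto simp: col_space_def)
      qed
      then have y: "y = fscale (y s) (unit_fun s)"
        by (auto simp: fun_eq_iff fscale_apply unit_fun_apply)
      have "y s = 0"
      proof (rule ccontr)
        assume "y s \<noteq> 0"
        then have "unit_fun s = fscale (inverse (y s)) y"
          by (subst y) simp
        then show False
          using s(2) fn.subspace_scale[OF X(1) yX] by metis
      qed
      then have "y = 0" using y by simp
      then have "x = (\<Sum>j<n - 1. fscale (x (skip s j)) (C j))"
        by (simp add: y_def)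
      also have "\<dots> \<in> fn.span (C ` {..<n - 1})"
        by (intro fn.span_sum fn.span_scale fn.span_base) auto
      finally show "x \<in> fn.span (C ` {..<n - 1})" .
    qed
  qed (use CX in auto)
  moreover have "(\<lambda>j. fun_of_vec (col ?M j)) ` {..<n - 1} = C ` {..<n - 1}"
    by (rule image_cong[OF refl]) (rule col, simp)
  ultimately show ?thesis
    by (intro exI[of _ ?M]) simp
qed

lemma tau_linear:
  "tau n X (u + v) = tau n X u + tau n X v" "tau n X (fscale c v) = fscale c (tau n X v)"
  by (simp_all add: tau_def fn.scale_left_distrib sum.distrib fn.scale_sum_right fscale_apply[of c v])

text \<open>Existence and uniqueness of the normal form make \<open>schubert_mat\<close> satisfy its
  description; the inverse of \<open>tau\<close> then reads off the pivot coordinates.\<close>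

lemma bij_betw_tau:
  fixes X :: "(nat \<Rightarrow> 'a::field) set"
  assumes "n \<ge> 1" and X: "fn.subspace X" "X \<subseteq> col_space n" "X \<noteq> col_space n"
    and hyp: "\<And>v w. v \<in> col_space n \<Longrightarrow> v \<notin> X \<Longrightarrow> w \<in> col_space n \<Longrightarrow> \<exists>c. w - fscale c v \<in> X"
  shows "bij_betw (tau n X) (col_space (n - 1)) X"
proof -
  define M where "M = schubert_mat n X"
  have "\<exists>!M. M \<in> carrier_mat n (n - 1) \<and> schubert_nf M \<and>
      fn.span ((\<lambda>j. fun_of_vec (col M j)) ` {..<n - 1}) = X"
    using schubert_exists[OF X hyp] schubert_unique[OF \<open>n \<ge> 1\<close>] by blast
  from theI'[OF this] have M: "M \<in> carrier_mat n (n - 1)" "schubert_nf M"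
      "fn.span ((\<lambda>j. fun_of_vec (col M j)) ` {..<n - 1}) = X"
    by (simp_all add: M_def schubert_mat_def)
  define C where "C j = fun_of_vec (col M j)" for j
  obtain r where "strict_mono_on {..<n - 1} r" and r: "\<And>j. j < n - 1 \<Longrightarrow> r j < n"
      "\<And>k j. k < n - 1 \<Longrightarrow> j < n - 1 \<Longrightarrow> M $$ (r k, j) = (if k = j then 1 else 0)"
    using M(1,2) unfolding schubert_nf_def by auto
  have piv: "C j (r k) = (if k = j then 1 else 0)" if "j < n - 1" "k < n - 1" for j k
    using r that M(1) by (auto simp: C_def fun_of_vec_def)
  have tau: "tau n X v = (\<Sum>j<n - 1. fscale (v j) (C j))" for v
    by (simp add: tau_def C_def M_def)
  have X_iff: "x \<in> X \<longleftrightarrow> x = (\<Sum>j<n - 1. fscale (x (r j)) (C j))" for x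
    using span_pivoted[where C = C and r = r and m = "n - 1"] piv M(3) by (auto simp: C_def[abs_def])
  have tau_r: "tau n X v (r k) = v k" if "k < n - 1" for v k
  proof -
    have "tau n X v (r k) = (\<Sum>j<n - 1. if j = k then v j else 0)"
      unfolding tau sum_apply using that by (intro sum.cong refl) (simp add: fscale_apply piv)
    then show ?thesis using that by simp
  qed
  show ?thesis
  proof (rule bij_betw_byWitness[where f' = "\<lambda>x j. if j < n - 1 then x (r j) else 0"])
    show "\<forall>v\<in>col_space (n - 1). (\<lambda>j. if j < n - 1 then tau n X v (r j) else 0) = v"
      by (auto simp: fun_eq_iff col_space_def tau_r)
    show "\<forall>x\<in>X. tau n X (\<lambda>j. if j < n - 1 then x (r j) else 0) = x"
    proof
      fix x assume "x \<in> X"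
      then have "x = (\<Sum>j<n - 1. fscale (x (r j)) (C j))"
        using X_iff by blast
      moreover have "tau n X (\<lambda>j. if j < n - 1 then x (r j) else 0) = (\<Sum>j<n - 1. fscale (x (r j)) (C j))"
        unfolding tau by (intro sum.cong refl) simp
      ultimately show "tau n X (\<lambda>j. if j < n - 1 then x (r j) else 0) = x"
        by metis
    qed
    show "tau n X ` col_space (n - 1) \<subseteq> X"
    proof (rule image_subsetI)
      fix v
      show "tau n X v \<in> X"
        unfolding X_iff by (subst tau) (intro sum.cong refl, simp add: tau_r)
    qed
    show "(\<lambda>x j. if j < n - 1 then x (r j) else 0) ` X \<subseteq> col_space (n - 1)"
      by (auto simp: col_space_def)
  qed
qed

section \<open>Additive characters\<close>

lemma affine_partI: "Y \<in> Bq (n + 1) \<Longrightarrow> \<not> Y \<subseteq> col_space n \<Longrightarrow> Y \<in> affine_part n"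
  by (simp add: affine_part_def)

lemma col_space_in_affine_part: "(col_space (n + 1) :: (nat \<Rightarrow> 'a::field) set) \<in> affine_part n"
proof (rule affine_partI)
  have "unit_fun n \<in> col_space (n + 1)" "unit_fun n \<notin> (col_space n :: (nat \<Rightarrow> 'a) set)"
    by simp_all
  then show "\<not> col_space (n + 1) \<subseteq> (col_space n :: (nat \<Rightarrow> 'a) set)" by blast
qed (simp add: Bq_def subspaces_of_def)

lemma card_col_space: "card (col_space m :: (nat \<Rightarrow> 'a::{field,finite}) set) = CARD('a) ^ m"
proof (induction m)
  case 0
  have "col_space 0 = {0 :: nat \<Rightarrow> 'a}"
    by (auto simp: col_space_def)
  then show ?case by simp
next
  case (Suc m)
  have "card (col_space (m + 1) :: (nat \<Rightarrow> 'a) set)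
      = CARD('a) * card (col_space (m + 1) \<inter> col_space m :: (nat \<Rightarrow> 'a) set)"
    by (rule card_affine_part[OF col_space_in_affine_part])
  moreover have "col_space (m + 1) \<inter> col_space m = (col_space m :: (nat \<Rightarrow> 'a) set)"
    using col_space_mono[of m "m + 1"] by auto
  ultimately show ?case
    using Suc by simp
qed

text \<open>The multiples of \<open>v\<close> represent the cosets of \<open>U\<close> in
  \<open>V\<close>, one for each scalar.\<close>

lemma card_subspace_complement:
  fixes U V :: "('i \<Rightarrow> 'a::{field,finite}) set"
  assumes U: "fn.subspace U" and V: "fn.subspace V" and "U \<subseteq> V" "v \<in> V" "v \<notin> U"
    and split: "\<And>w. w \<in> V \<Longrightarrow> \<exists>c. w - fscale c v \<in> U"
  shows "card V = CARD('a) * card U"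
proof -
  let ?f = "\<lambda>(c, z). fscale c v + z"
  have "bij_betw ?f (UNIV \<times> U) V"
    unfolding bij_betw_def
  proof (intro conjI inj_onI)
    fix p p' assume p: "p \<in> UNIV \<times> U" "p' \<in> UNIV \<times> U" and eq: "?f p = ?f p'"
    obtain c z d y where [simp]: "p = (c, z)" "p' = (d, y)"
      by (cases p, cases p')
    have "fscale (c - d) v = y - z"
      using eq by (simp add: fn.scale_left_diff_distrib algebra_simps)
    then have "fscale (c - d) v \<in> U"
      using p fn.subspace_diff[OF U, of y z] by simp
    then have "c = d"
      using \<open>v \<notin> U\<close> fn.subspace_scale[OF U, of "fscale (c - d) v" "inverse (c - d)"]
      by (cases "c = d") auto
    with eq show "p = p'" by simp
  next
    show "?f ` (UNIV \<times> U) = V"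
    proof (intro subset_antisym subsetI)
      fix w assume "w \<in> ?f ` (UNIV \<times> U)"
      then obtain c z where "w = fscale c v + z" "z \<in> U" by auto
      then show "w \<in> V"
        using assms by (auto intro!: fn.subspace_add[OF V] fn.subspace_scale[OF V])
    next
      fix w assume "w \<in> V"
      then obtain c where "w - fscale c v \<in> U" using split by blast
      then show "w \<in> ?f ` (UNIV \<times> U)"
        by (intro image_eqI[of _ _ "(c, w - fscale c v)"]) auto
    qed
  qed
  from bij_betw_same_card[OF this] show ?thesis
    by (simp add: card_cartesian_product)
qed

text \<open>Reindexing by \<open>h\<close> multiplies the sum by \<open>c\<close>. With a
  translation as \<open>h\<close> this yields the vanishing character sums below.\<close>

lemma sum_scaled_characters_eq_0:
  fixes f :: "'s \<Rightarrow> complex"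
  assumes "bij_betw h S S" and "\<And>s. s \<in> S \<Longrightarrow> f (h s) = c * f s" and "c \<noteq> 1"
  shows "sum f S = 0"
proof -
  have "sum f S = (\<Sum>s\<in>S. f (h s))"
    using sum.reindex_bij_betw[OF assms(1), of f] by simp
  also have "\<dots> = c * sum f S"
    using assms(2) by (simp add: sum_distrib_left)
  finally show ?thesis
    using assms(3) by simp
qed

lemma bij_betw_translate_subspace:
  assumes "fn.subspace Z" "z \<in> Z"
  shows "bij_betw (\<lambda>x. z + x) Z Z"
  using assms by (intro bij_betw_byWitness[where f' = "\<lambda>x. x - z"])
    (auto intro: fn.subspace_add fn.subspace_diff)

section \<open>Values, kernel and orthogonality of a nontrivial additive character\<close>

locale additive_character =
  fixes n :: nat and psi :: "(nat \<Rightarrow> 'a::{field,finite}) \<Rightarrow> complex"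
  assumes psi_add: "a \<in> col_space n \<Longrightarrow> b \<in> col_space n \<Longrightarrow> psi (a + b) = psi a * psi b"
    and psi_nonzero: "a \<in> col_space n \<Longrightarrow> psi a \<noteq> 0"
    and nontrivial: "\<exists>a\<in>col_space n. psi a \<noteq> 1"
begin

abbreviation V :: "(nat \<Rightarrow> 'a) set" where "V \<equiv> col_space n"

lemma V_closed [simp]:
  "0 \<in> V" "a \<in> V \<Longrightarrow> b \<in> V \<Longrightarrow> a + b \<in> V" "a \<in> V \<Longrightarrow> b \<in> V \<Longrightarrow> a - b \<in> V"
  "a \<in> V \<Longrightarrow> - a \<in> V" "a \<in> V \<Longrightarrow> fscale c a \<in> V"
  using subspace_col_space[of n]
  by (simp_all add: fn.subspace_0 fn.subspace_add fn.subspace_diff fn.subspace_neg fn.subspace_scale)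

lemma psi_0 [simp]: "psi 0 = 1"
  using psi_add[of 0 0] psi_nonzero[of 0] by simp

text \<open>Translation by \<open>a\<close> permutes \<open>V\<close>, so comparing the products of
  \<open>psi\<close> over \<open>V\<close> before and after gives \<open>psi a ^ card V = 1\<close>:
  the values are roots of unity.\<close>

lemma norm_psi:
  assumes "a \<in> V" shows "norm (psi a) = 1"
proof -
  have "(\<Prod>x\<in>V. psi x) = (\<Prod>x\<in>V. psi (a + x))"
    using prod.reindex_bij_betw[OF bij_betw_translate_subspace, of V a psi] assms by simp
  also have "\<dots> = psi a ^ card V * (\<Prod>x\<in>V. psi x)"
    using assms by (simp add: psi_add prod.distrib)
  finally have pow: "psi a ^ card V = 1"
    using psi_nonzero by simp
  have "card V \<noteq> 0"
    using V_closed(1) by (auto simp del: V_closed)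
  then show ?thesis
    using power_eq_1_iff[OF pow] by linarith
qed

text \<open>On \<open>V\<close> the conjugate is the inverse of \<open>psi\<close>; it is the weight
  of the group sum in \<open>char_proj\<close>.\<close>

definition kap :: "(nat \<Rightarrow> 'a) \<Rightarrow> complex" where "kap a = cnj (psi a)"

lemma kap_psi: "a \<in> V \<Longrightarrow> kap a * psi a = 1"
  using norm_psi[of a] by (simp add: kap_def mult.commute[of "cnj _"] complex_norm_square[symmetric])

lemma kap_add: "a \<in> V \<Longrightarrow> b \<in> V \<Longrightarrow> kap (a + b) = kap a * kap b"
  by (simp add: kap_def psi_add)

lemma kap_0 [simp]: "kap 0 = 1"
  by (simp add: kap_def)

lemma kap_eq_1_iff: "kap a = 1 \<longleftrightarrow> psi a = 1"
  by (metis kap_def complex_cnj_cnj complex_cnj_one)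

lemma kap_diff: "a \<in> V \<Longrightarrow> b \<in> V \<Longrightarrow> kap (a - b) = kap a * psi b"
  using kap_add[of "a - b" b] kap_psi[of b] by (simp add: mult.assoc)

text \<open>Asking for all multiples makes this a subspace; \<open>psi v = 1\<close> alone defines
  in general only an additive subgroup.\<close>

definition ker :: "(nat \<Rightarrow> 'a) set" where
  "ker = {v \<in> V. \<forall>c. psi (fscale c v) = 1}"

lemma ker_subset: "ker \<subseteq> V"
  by (auto simp: ker_def)

lemma psi_ker: "x \<in> ker \<Longrightarrow> psi x = 1"
  unfolding ker_def using fn.scale_one[of x] by (metis (mono_tags, lifting) mem_Collect_eq)

lemma subspace_ker: "fn.subspace ker"
  unfolding fn.subspace_def ker_def
  by (auto simp: fn.scale_right_distrib psi_add)

lemma subset_ker_iff: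
  assumes "fn.subspace Z" "Z \<subseteq> V"
  shows "Z \<subseteq> ker \<longleftrightarrow> (\<forall>z\<in>Z. psi z = 1)"
  using assms psi_ker fn.subspace_scale[OF assms(1)] by (auto simp: ker_def)

lemma sum_kap_subspace:
  assumes Z: "fn.subspace Z" "Z \<subseteq> V"
  shows "(\<Sum>z\<in>Z. kap z) = (if Z \<subseteq> ker then of_nat (card Z) else 0)"
proof (cases "Z \<subseteq> ker")
  case True
  then have "kap z = 1" if "z \<in> Z" for z
    using psi_ker that by (auto simp: kap_eq_1_iff)
  then show ?thesis
    using True by simp
next
  case False
  then obtain z where z: "z \<in> Z" "kap z \<noteq> 1"
    using subset_ker_iff[OF Z] kap_eq_1_iff by auto
  have "sum kap Z = 0"
    by (rule sum_scaled_characters_eq_0[OF bij_betw_translate_subspace[OF Z(1) z(1)] _ z(2)])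
      (use z Z in \<open>auto intro!: kap_add\<close>)
  then show ?thesis
    using False by simp
qed

text \<open>For fixed \<open>x\<close> the map from \<open>c\<close> to
  \<open>psi (fscale c x)\<close> is a character of the additive group of the field, trivial exactly
  when \<open>x\<close> is in \<open>ker\<close>.\<close>

lemma sum_psi_line:
  assumes x: "x \<in> V"
  shows "(\<Sum>c\<in>UNIV. psi (fscale c x)) = (if x \<in> ker then of_nat CARD('a) else 0)"
proof (cases "x \<in> ker")
  case True
  then show ?thesis by (simp add: ker_def)
next
  case False
  then obtain d where d: "psi (fscale d x) \<noteq> 1"
    using x by (auto simp: ker_def)
  have "bij_betw ((+) d) (UNIV :: 'a set) UNIV"
    by (intro bij_betw_byWitness[where f' = "\<lambda>c. c - d"]) auto
  from sum_scaled_characters_eq_0[OF this _ d, of "\<lambda>c. psi (fscale c x)"]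
  show ?thesis
    using False x by (simp add: fn.scale_left_distrib psi_add)
qed

text \<open>If \<open>v\<close> and \<open>w\<close> were independent modulo \<open>ker\<close>, then evaluating the sum of
  \<open>psi (c (a v + b w))\<close> over all scalars \<open>a, b, c\<close> in the two possible orders would give
  both \<open>q\<close> and \<open>q\<^sup>2\<close>.\<close>

lemma ker_complement:
  assumes v: "v \<in> V" "v \<notin> ker" and w: "w \<in> V"
  shows "\<exists>c. w - fscale c v \<in> ker"
proof (rule ccontr)
  assume contr: "\<not> ?thesis"
  let ?q = "of_nat CARD('a) :: complex"
  let ?S = "\<Sum>a\<in>UNIV. \<Sum>b\<in>UNIV. \<Sum>c\<in>UNIV. psi (fscale c (fscale a v + fscale b w))"
  have not_ker: "fscale a v + fscale b w \<in> ker \<longleftrightarrow> a = 0 \<and> b = 0" for a b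
  proof
    assume *: "fscale a v + fscale b w \<in> ker"
    have "b = 0"
    proof (rule ccontr)
      assume "b \<noteq> 0"
      then have "fscale (inverse b) (fscale a v + fscale b w) = w - fscale (- (inverse b * a)) v"
        by (simp add: fn.scale_right_distrib)
      then show False
        using contr fn.subspace_scale[OF subspace_ker *, of "inverse b"] by metis
    qed
    moreover have "a = 0"
    proof (rule ccontr)
      assume "a \<noteq> 0"
      with \<open>b = 0\<close> show False
        using v fn.subspace_scale[OF subspace_ker *, of "inverse a"] by simp
    qed
    ultimately show "a = 0 \<and> b = 0" by simp
  qed (use fn.subspace_0[OF subspace_ker] in simp)
  have "?S = (\<Sum>a\<in>UNIV. \<Sum>b\<in>UNIV. if a = (0::'a) \<and> b = (0::'a) then ?q else 0)"
    using v w by (simp add: sum_psi_line not_ker)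
  also have "\<dots> = (\<Sum>a\<in>UNIV. if a = (0::'a) then ?q else 0)"
    by (intro sum.cong refl) simp
  also have "\<dots> = ?q"
    by simp
  finally have 1: "?S = ?q" .
  have inner: "(\<Sum>a\<in>UNIV. psi (fscale (c * a) v)) = (if c = 0 then ?q else 0)"
    if v: "v \<in> V" "v \<notin> ker" for v and c :: 'a
  proof (cases "c = 0")
    case False
    have "bij_betw ((*) c) (UNIV :: 'a set) UNIV"
      using False by (intro bij_betw_byWitness[where f' = "\<lambda>x. x / c"]) auto
    from sum.reindex_bij_betw[OF this, of "\<lambda>c. psi (fscale c v)"]
    show ?thesis
      using False sum_psi_line[OF v(1)] v by simp
  qed simp
  have "?S = (\<Sum>c\<in>UNIV. \<Sum>a\<in>UNIV. \<Sum>b\<in>UNIV. psi (fscale (c * a) v) * psi (fscale (c * b) w))"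
    by (subst sum.swap[of _ UNIV UNIV], subst sum.swap[of _ UNIV UNIV])
      (use v w in \<open>simp add: fn.scale_right_distrib psi_add\<close>)
  also have "\<dots> = (\<Sum>c\<in>UNIV. (\<Sum>a\<in>UNIV. psi (fscale (c * a) v)) * (\<Sum>b\<in>UNIV. psi (fscale (c * b) w)))"
    by (simp add: sum_product)
  \<comment> \<open>Only \<open>c = 0\<close> survives. The instance \<open>not_ker[of 0 1]\<close>
    says that \<open>w\<close> is not in \<open>ker\<close>, so \<open>inner\<close> applies to the
    second factor too.\<close>
  also have "\<dots> = (\<Sum>c\<in>UNIV. if c = (0::'a) then ?q * ?q else 0)"
    using v w not_ker[of 0 1] by (intro sum.cong refl) (simp add: inner)
  also have "\<dots> = ?q * ?q"
    by simp
  finally have "CARD('a) * CARD('a) = CARD('a)"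
    using 1 by (metis of_nat_eq_iff of_nat_mult)
  then show False
    using CARD_gt_1[where 'a = 'a] by simp
qed

lemma ker_neq: "\<exists>v\<in>V. v \<notin> ker"
  using nontrivial psi_ker by blast

lemma card_V_ker: "card V = CARD('a) * card ker"
proof -
  obtain v where "v \<in> V" "v \<notin> ker"
    using ker_neq by blast
  then show ?thesis
    by (intro card_subspace_complement[of ker V v] subspace_ker subspace_col_space ker_subset ker_complement)
qed

text \<open>Averaging over the slice avoids the choice of one translation vector for
  \<open>Y\<close>.\<close>

definition khat :: "(nat \<Rightarrow> 'a) set \<Rightarrow> complex" where
  "khat Y = (\<Sum>a\<in>slice n Y. kap a) / of_nat (card (slice n Y))"

text \<open>The slice is a coset of the trace, so the average is \<open>kap a\<close> times the
  average of \<open>kap\<close> over the trace, which is 1 or 0.\<close>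

lemma khat_eq:
  assumes Y: "Y \<in> affine_part n" and a: "a \<in> slice n Y"
  shows "khat Y = (if Y \<inter> V \<subseteq> ker then kap a else 0)"
proof -
  have aV: "a \<in> V" using a by (simp add: slice_def)
  have Z: "fn.subspace (Y \<inter> V)" "finite (Y \<inter> V)"
    using BqD[OF affine_partD(5)[OF Y]] by auto
  have "(\<Sum>b\<in>slice n Y. kap b) = (\<Sum>z\<in>Y \<inter> V. kap (a + z))"
    by (simp add: slice_eq_translate[OF Y a] sum.reindex)
  also have "\<dots> = kap a * (\<Sum>z\<in>Y \<inter> V. kap z)"
    using aV by (auto simp: kap_add sum_distrib_left intro!: sum.cong)
  finally show ?thesis
    using card_subspace_pos[OF Z] sum_kap_subspace[OF Z(1)]
    by (auto simp: khat_def card_slice[OF Y] card_gt_0_iff)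
qed

definition lift :: "((nat \<Rightarrow> 'a) set \<Rightarrow> complex) \<Rightarrow> (nat \<Rightarrow> 'a) set \<Rightarrow> complex" where
  "lift u Y = (if Y \<in> affine_part n \<and> Y \<inter> V \<subseteq> ker then u (Y \<inter> V) * khat Y else 0)"

text \<open>Within \<open>affine_part n\<close>, passing to the trace divides both cardinalities by
  q.\<close>

lemma covers_Int:
  assumes Y: "Y \<in> affine_part n" "Y' \<in> affine_part n"
  shows "covers Y' Y \<longleftrightarrow> Y \<subseteq> Y' \<and> covers (Y' \<inter> V) (Y \<inter> V)"
proof -
  note D = affine_partD[OF Y(1)] affine_partD[OF Y(2)]
  have "covers Y' Y \<longleftrightarrow> Y \<subseteq> Y' \<and> card Y' = CARD('a) * card Y"
    using D by (intro covers_iff_card) auto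
  moreover have "covers (Y' \<inter> V) (Y \<inter> V) \<longleftrightarrow>
      Y \<inter> V \<subseteq> Y' \<inter> V \<and> card (Y' \<inter> V) = CARD('a) * card (Y \<inter> V)"
    using D by (intro covers_iff_card BqD(1,3)[of _ n])
  ultimately show ?thesis
    unfolding card_affine_part[OF Y(1)] card_affine_part[OF Y(2)]
    using CARD_gt_1[where 'a = 'a] by auto
qed

text \<open>\<open>Y\<close> has q times as many elements as its trace, so a subspace of the trace
  with \<open>card Y / q\<close> elements is the whole trace.\<close>

lemma covers_Bq:
  assumes Y: "Y \<in> affine_part n" and Z: "Z \<in> Bq n"
  shows "covers Y Z \<longleftrightarrow> Y \<inter> V = Z"
proof -
  note D = affine_partD[OF Y] BqD[OF Z]
  have "covers Y Z \<longleftrightarrow> Z \<subseteq> Y \<and> card Y = CARD('a) * card Z"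
    using D by (intro covers_iff_card) auto
  also have "\<dots> \<longleftrightarrow> Z \<subseteq> Y \<inter> V \<and> card (Y \<inter> V) = card Z"
    using D(8) CARD_gt_1[where 'a = 'a] unfolding card_affine_part[OF Y] by simp
  also have "\<dots> \<longleftrightarrow> Y \<inter> V = Z"
    using D(3) card_subset_eq[of "Y \<inter> V" Z] by auto
  finally show ?thesis .
qed

lemma cone_mono: "Z \<subseteq> Z' \<Longrightarrow> cone n Z a \<subseteq> cone n Z' a"
  by (auto simp: cone_def)

lemma slice_mono: "Y \<subseteq> Y' \<Longrightarrow> slice n Y \<subseteq> slice n Y'"
  by (auto simp: slice_def)

lemma slice_subset: "slice n Y \<subseteq> V"
  by (auto simp: slice_def)

lemma finite_slice [simp]: "finite (slice n Y :: (nat \<Rightarrow> 'a) set)"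
  using finite_subset[OF slice_subset finite_col_space] .

text \<open>The slices of the subspaces \<open>Y\<close> with \<open>Y \<inter> V = Z\<close> below \<open>Y'\<close> partition the slice of \<open>Y'\<close>.\<close>

lemma sum_khat_fibre:
  assumes Y': "Y' \<in> affine_part n" and Z: "Z \<in> Bq n" "Z \<subseteq> Y'"
  shows "(\<Sum>Y | Y \<in> affine_part n \<and> Y \<subseteq> Y' \<and> Y \<inter> V = Z. khat Y) * of_nat (card Z)
    = (\<Sum>a\<in>slice n Y'. kap a)"
proof -
  let ?T = "{Y. Y \<in> affine_part n \<and> Y \<subseteq> Y' \<and> Y \<inter> V = Z}"
  have cardZ: "card Z \<noteq> 0"
    using card_subspace_pos[OF BqD(1,3)[OF Z(1)]] by simp
  have fin: "finite ?T"
    by (rule finite_subset[of _ "affine_part n"]) auto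
  have "cone n Z a \<subseteq> Y'" if "a \<in> slice n Y'" for a
    using cone_mono[of Z "Y' \<inter> V" a] cone_slice[OF Y' that] Z(2) BqD(2)[OF Z(1)] by auto
  then have img: "cone n Z ` slice n Y' \<subseteq> ?T"
    using cone_in_affine_part[OF Z(1)] slice_subset by blast
  have fib: "{a \<in> slice n Y'. cone n Z a = Y} = slice n Y" if "Y \<in> ?T" for Y
    using that cone_eq_iff[OF Z(1), of _ Y] slice_subset slice_mono[of Y Y'] by auto
  have "(\<Sum>Y\<in>?T. khat Y) * of_nat (card Z) = (\<Sum>Y\<in>?T. \<Sum>a\<in>slice n Y. kap a)"
    unfolding sum_distrib_right
    by (intro sum.cong refl) (use cardZ in \<open>auto simp: khat_def card_slice\<close>)
  also have "\<dots> = (\<Sum>Y\<in>?T. \<Sum>a | a \<in> slice n Y' \<and> cone n Z a = Y. kap a)"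
    by (intro sum.cong refl) (simp add: fib)
  also have "\<dots> = (\<Sum>a\<in>slice n Y'. kap a)"
    by (rule sum.group[OF finite_slice fin img])
  finally show ?thesis .
qed

end

section \<open>The adjacency operator on lifted functions\<close>

text \<open>Reading off a coefficient reverses the roles: the contributing \<open>Z\<close> are
  those that \<open>Y'\<close> covers or that cover \<open>Y'\<close>. In the second case
  \<open>fn.dim Z - 1\<close> is \<open>fn.dim Y'\<close>, so the weight is the same for all
  \<open>Z\<close>.\<close>

lemma adj_op_apply:
  "adj_op m w Y' = (if Y' \<in> Bq m
     then (\<Sum>Y | Y \<in> Bq m \<and> covers Y' Y. w Y)
       + of_nat CARD('a) ^ fn.dim Y' * (\<Sum>Y | Y \<in> Bq m \<and> covers Y Y'. w Y)
     else 0)"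
  for Y' :: "(nat \<Rightarrow> 'a::{field,finite}) set"
proof -
  have up: "(\<Sum>Z' | Z' \<in> Bq m \<and> covers Z' Z. unit_fun Z' Y') = (if Y' \<in> Bq m \<and> covers Y' Z then 1 else 0 :: complex)"
    and down: "(\<Sum>Z' | Z' \<in> Bq m \<and> covers Z Z'. unit_fun Z' Y') = (if Y' \<in> Bq m \<and> covers Z Y' then 1 else 0 :: complex)" for Z
    by (simp_all add: unit_fun_apply sum.delta)
  have "adj_op m w Y' = (\<Sum>Z\<in>Bq m. w Z * ((if Y' \<in> Bq m \<and> covers Y' Z then 1 else 0)
      + of_nat CARD('a) ^ (fn.dim Z - 1) * (if Y' \<in> Bq m \<and> covers Z Y' then 1 else 0)))"
    unfolding adj_op_def lin_ext_apply
    by (simp only: plus_fun_apply fscale_apply sum_apply up down)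
  also have "\<dots> = (if Y' \<in> Bq m then (\<Sum>Z\<in>Bq m. if covers Y' Z then w Z else 0)
      + of_nat CARD('a) ^ fn.dim Y' * (\<Sum>Z\<in>Bq m. if covers Z Y' then w Z else 0) else 0)"
  proof (cases "Y' \<in> Bq m")
    case True
    have "w Z * ((if Y' \<in> Bq m \<and> covers Y' Z then 1 else 0)
          + of_nat CARD('a) ^ (fn.dim Z - 1) * (if Y' \<in> Bq m \<and> covers Z Y' then 1 else 0))
        = (if covers Y' Z then w Z else 0)
          + of_nat CARD('a) ^ fn.dim Y' * (if covers Z Y' then w Z else 0)" for Z
      using True by (simp add: covers_def)
    then show ?thesis
      using True by (simp add: sum.distrib sum_distrib_left)
  qed simp
  finally show ?thesis
    by (simp add: sum.inter_filter)
qed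

section \<open>Sums of a lifted function over the two cover relations\<close>

context additive_character begin

abbreviation up_sum :: "((nat \<Rightarrow> 'a) set \<Rightarrow> complex) \<Rightarrow> (nat \<Rightarrow> 'a) set \<Rightarrow> complex" where
  "up_sum u Z' \<equiv> (\<Sum>Z | Z \<in> subspaces_of ker \<and> covers Z Z'. u Z)"

abbreviation down_sum :: "((nat \<Rightarrow> 'a) set \<Rightarrow> complex) \<Rightarrow> (nat \<Rightarrow> 'a) set \<Rightarrow> complex" where
  "down_sum u Z' \<equiv> (\<Sum>Z | Z \<in> subspaces_of ker \<and> covers Z' Z. u Z)"

lemma subspaces_of_ker_Bq: "Z \<in> subspaces_of ker \<longleftrightarrow> Z \<in> Bq n \<and> Z \<subseteq> ker"
  using ker_subset by (auto simp: Bq_def subspaces_of_def)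

lemma covers_subset: "covers Z' Z \<Longrightarrow> Z \<subseteq> Z'"
  by (simp add: covers_def)

text \<open>Group the \<open>Y\<close> by their trace \<open>Z\<close>. In one group the
  \<open>khat\<close> add up to the sum of \<open>kap\<close> over the slice of \<open>Y'\<close>,
  divided by \<open>card Z\<close>; this slice has q times \<open>card Z\<close> elements, hence the
  factor q.\<close>

lemma sum_lift_below:
  assumes Y': "Y' \<in> affine_part n"
  shows "(\<Sum>Y | Y \<in> Bq (n + 1) \<and> covers Y' Y. lift u Y)
    = of_nat CARD('a) * lift (down_sum u) Y'"
proof -
  let ?C = "{Y. Y \<in> affine_part n \<and> covers Y' Y \<and> Y \<inter> V \<subseteq> ker}"
  let ?D = "{Z. Z \<in> subspaces_of ker \<and> covers (Y' \<inter> V) Z}"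
  obtain b where b: "b \<in> slice n Y'"
    using affine_partD(6)[OF Y'] by blast
  have fin: "finite ?C" "finite ?D"
    by (simp_all add: subspaces_of_ker_Bq)
  have img: "(\<lambda>Y. Y \<inter> V) ` ?C \<subseteq> ?D"
    using covers_Int[OF _ Y'] affine_partD(5) by (auto simp only: subspaces_of_ker_Bq)
  have "(\<Sum>Y | Y \<in> Bq (n + 1) \<and> covers Y' Y. lift u Y) = (\<Sum>Y\<in>?C. u (Y \<inter> V) * khat Y)"
    using affine_partD(4)
    by (intro sum.mono_neutral_cong_right) (auto simp: lift_def)
  also have "\<dots> = (\<Sum>Z\<in>?D. \<Sum>Y | Y \<in> ?C \<and> Y \<inter> V = Z. u (Y \<inter> V) * khat Y)"
    by (rule sum.group[OF fin img, symmetric])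
  also have "\<dots> = (\<Sum>Z\<in>?D. u Z * (of_nat CARD('a) * khat Y'))"
  proof (rule sum.cong[OF refl])
    fix Z assume "Z \<in> ?D"
    then have Z: "Z \<in> Bq n" "covers (Y' \<inter> V) Z" "Z \<subseteq> Y'" "Z \<subseteq> ker"
      by (auto simp: subspaces_of_ker_Bq dest: covers_subset)
    note Z' = BqD[OF affine_partD(5)[OF Y']]
    have card: "card (Y' \<inter> V) = CARD('a) * card Z" "card Z \<noteq> 0"
      using Z Z' BqD[OF Z(1)] covers_iff_card[of Z "Y' \<inter> V"] card_subspace_pos[of Z] by auto
    have "{Y \<in> ?C. Y \<inter> V = Z} = {Y. Y \<in> affine_part n \<and> Y \<subseteq> Y' \<and> Y \<inter> V = Z}"
      using covers_Int[OF _ Y'] Z(2,4) by blast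
    then have "(\<Sum>Y | Y \<in> ?C \<and> Y \<inter> V = Z. khat Y) * of_nat (card Z) = (\<Sum>a\<in>slice n Y'. kap a)"
      using sum_khat_fibre[OF Y' Z(1,3)] by simp
    also have "\<dots> = khat Y' * of_nat (card (Y' \<inter> V))"
      using card CARD_gt_1[where 'a = 'a] by (simp add: khat_def card_slice[OF Y'])
    finally have "(\<Sum>Y | Y \<in> ?C \<and> Y \<inter> V = Z. khat Y) = of_nat CARD('a) * khat Y'"
      using card by simp
    moreover have "(\<Sum>Y | Y \<in> ?C \<and> Y \<inter> V = Z. u (Y \<inter> V) * khat Y)
        = u Z * (\<Sum>Y | Y \<in> ?C \<and> Y \<inter> V = Z. khat Y)"
      by (simp add: sum_distrib_left)
    ultimately show "(\<Sum>Y | Y \<in> ?C \<and> Y \<inter> V = Z. u (Y \<inter> V) * khat Y)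
        = u Z * (of_nat CARD('a) * khat Y')"
      by simp
  qed
  \<comment> \<open>When the trace of \<open>Y'\<close> is not in \<open>ker\<close>, the right side
    is 0 by \<open>lift_def\<close> and the left side because \<open>khat Y' = 0\<close>.\<close>
  also have "\<dots> = of_nat CARD('a) * lift (down_sum u) Y'"
    using Y' khat_eq[OF Y' b] by (simp add: lift_def sum_distrib_right[symmetric] mult_ac)
  finally show ?thesis .
qed

text \<open>A point \<open>b\<close> of the slice of \<open>Y'\<close> lies in the slice of every
  \<open>Y\<close> above it, so \<open>Y\<close> is the cone over its trace at \<open>b\<close>, and
  the same \<open>b\<close> computes both \<open>khat Y\<close> and \<open>khat Y'\<close>.\<close>

lemma sum_lift_above:
  assumes Y': "Y' \<in> affine_part n"
  shows "(\<Sum>Y | Y \<in> Bq (n + 1) \<and> covers Y Y'. lift u Y) = lift (up_sum u) Y'"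
proof (cases "Y' \<inter> V \<subseteq> ker")
  case True
  let ?C = "{Y. Y \<in> affine_part n \<and> covers Y Y' \<and> Y \<inter> V \<subseteq> ker}"
  let ?D = "{Z. Z \<in> subspaces_of ker \<and> covers Z (Y' \<inter> V)}"
  obtain b where b: "b \<in> slice n Y'"
    using affine_partD(6)[OF Y'] by blast
  have bV: "b \<in> V" using b slice_subset by blast
  have bY: "b \<in> slice n Y" if "Y \<in> ?C" for Y
    using that b slice_mono[of Y' Y] by (auto dest: covers_subset)
  have "(\<Sum>Y | Y \<in> Bq (n + 1) \<and> covers Y Y'. lift u Y) = (\<Sum>Y\<in>?C. u (Y \<inter> V) * khat Y)"
    using affine_partD(4)
    by (intro sum.mono_neutral_cong_right) (auto simp: lift_def)
  also have "\<dots> = (\<Sum>Z\<in>?D. u Z * khat Y')"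
  proof (rule sum.reindex_bij_witness[where i = "\<lambda>Z. cone n Z b" and j = "\<lambda>Y. Y \<inter> V"])
    fix Y assume Y: "Y \<in> ?C"
    then show "cone n (Y \<inter> V) b = Y"
      using cone_slice bY[OF Y] by blast
    show "Y \<inter> V \<in> ?D"
      using Y covers_Int[OF Y', of Y] affine_partD(5)[of Y n] by (simp add: subspaces_of_ker_Bq)
    show "u (Y \<inter> V) * khat Y' = u (Y \<inter> V) * khat Y"
      using Y khat_eq[OF Y' b] khat_eq[OF _ bY[OF Y]] True by simp
  next
    fix Z assume "Z \<in> ?D"
    then have Z: "Z \<in> Bq n" "Z \<subseteq> ker" "covers Z (Y' \<inter> V)"
      by (auto simp: subspaces_of_ker_Bq)
    show cap: "cone n Z b \<inter> V = Z"
      using cone_in_affine_part(2)[OF Z(1) bV] .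
    have "Y' \<subseteq> cone n Z b"
      using cone_mono[of "Y' \<inter> V" Z b] cone_slice[OF Y' b] covers_subset[OF Z(3)] by simp
    then show "cone n Z b \<in> ?C"
      using cone_in_affine_part(1)[OF Z(1) bV] covers_Int[OF Y', of "cone n Z b"] Z cap by simp
  qed
  also have "\<dots> = lift (up_sum u) Y'"
    using True Y' by (simp add: lift_def sum_distrib_right)
  finally show ?thesis .
next
  case False
  have "lift u Y = 0" if "covers Y Y'" for Y
    using False covers_subset[OF that] by (auto simp: lift_def)
  then show ?thesis
    using False by (simp add: lift_def)
qed

text \<open>The covers of \<open>Z\<close> in \<open>affine_part n\<close> are the \<open>Y\<close>
  with trace \<open>Z\<close>. For \<open>Z\<close> in \<open>ker\<close>,
  \<open>sum_khat_fibre\<close> applied to the whole space turns their sum into that of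
  \<open>kap\<close> over \<open>V\<close>, which is 0 because \<open>psi\<close> is
  nontrivial.\<close>

lemma sum_lift_above_flat:
  assumes Z: "Z \<in> Bq n"
  shows "(\<Sum>Y | Y \<in> Bq (n + 1) \<and> covers Y Z. lift u Y) = 0"
proof (cases "Z \<subseteq> ker")
  case True
  let ?T = "{Y. Y \<in> affine_part n \<and> Y \<subseteq> col_space (n + 1) \<and> Y \<inter> V = Z}"
  have "(\<Sum>Y | Y \<in> Bq (n + 1) \<and> covers Y Z. lift u Y) = (\<Sum>Y\<in>?T. u Z * khat Y)"
    using affine_partD(2,4) True covers_Bq[OF _ Z]
    by (intro sum.mono_neutral_cong_right) (auto simp: lift_def)
  also have "\<dots> = u Z * (\<Sum>Y\<in>?T. khat Y)"
    by (simp add: sum_distrib_left)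
  also have "(\<Sum>Y\<in>?T. khat Y) = 0"
  proof -
    have top: "col_space (n + 1) \<in> affine_part n"
      by (rule col_space_in_affine_part)
    have "Z \<subseteq> col_space (n + 1)"
      using BqD(2)[OF Z] col_space_mono[of n "n + 1"] by auto
    from sum_khat_fibre[OF top Z this]
    have "(\<Sum>Y\<in>?T. khat Y) * of_nat (card Z) = (\<Sum>a\<in>slice n (col_space (n + 1)). kap a)" .
    also have "slice n (col_space (n + 1)) = V"
      by (auto simp: slice_def col_space_def unit_fun_apply)
    also have "(\<Sum>a\<in>V. kap a) = 0"
      using sum_kap_subspace[of V] ker_neq by auto
    finally show ?thesis
      using card_subspace_pos[OF BqD(1,3)[OF Z]] by (auto simp: card_gt_0_iff)
  qed
  finally show ?thesis by simp
next
  case False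
  have "lift u Y = 0" if "covers Y Z" for Y
    using False covers_subset[OF that] BqD(2)[OF Z] by (auto simp: lift_def)
  then show ?thesis by simp
qed

lemma dim_affine_part:
  assumes "Y \<in> affine_part n"
  shows "fn.dim Y = fn.dim (Y \<inter> V) + 1"
  using covers_Bq[OF assms affine_partD(5)[OF assms]] by (simp add: covers_def)

text \<open>The down part has its factor q from \<open>sum_lift_below\<close>, the up part from the
  exponent, since \<open>fn.dim Y\<close> exceeds the dimension of the trace by one.\<close>

lemma adj_op_lift:
  "adj_op (n + 1) (lift u)
    = lift (\<lambda>Z. of_nat CARD('a) * (down_sum u Z + of_nat CARD('a) ^ fn.dim Z * up_sum u Z))"
proof
  fix Y :: "(nat \<Rightarrow> 'a) set"
  consider "Y \<in> affine_part n" | "Y \<in> Bq n" | "Y \<notin> Bq (n + 1)"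
    by (auto simp: affine_part_def Bq_def subspaces_of_def)
  then show "adj_op (n + 1) (lift u) Y
    = lift (\<lambda>Z. of_nat CARD('a) * (down_sum u Z + of_nat CARD('a) ^ fn.dim Z * up_sum u Z)) Y"
  proof cases
    case 1
    then show ?thesis
      by (simp only: adj_op_apply sum_lift_below sum_lift_above dim_affine_part affine_partD(4) if_True)
        (simp add: lift_def algebra_simps)
  next
    case 2
    \<comment> \<open>Whatever \<open>Y\<close> covers lies in \<open>F^n\<close> again, where lifts
      vanish; the covers of \<open>Y\<close> cancel by \<open>sum_lift_above_flat\<close>.\<close>
    have flat: "lift u' Z = 0" if "Z \<subseteq> Y" for u' Z
      using that BqD(2)[OF 2] by (auto simp: lift_def affine_part_def)
    then have "(\<Sum>Z | Z \<in> Bq (n + 1) \<and> covers Y Z. lift u Z) = 0"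
      by (auto intro!: sum.neutral dest: covers_subset)
    then show ?thesis
      using sum_lift_above_flat[OF 2] by (simp add: adj_op_apply flat)
  next
    case 3
    then show ?thesis
      by (auto simp: adj_op_apply lift_def affine_part_def)
  qed
qed

end

section \<open>The group action\<close>

definition shear_mat :: "nat \<Rightarrow> (nat \<Rightarrow> 'a::field) \<Rightarrow> 'a mat" where
  "shear_mat n a = four_block_mat (1\<^sub>m n) (mat n 1 (\<lambda>(i, j). a i)) (0\<^sub>m 1 n) (1\<^sub>m 1)"

lemma shear_mat_carrier [simp]: "shear_mat n a \<in> carrier_mat (n + 1) (n + 1)"
  unfolding shear_mat_def by (rule four_block_carrier_mat) auto

lemma shear_mat_index:
  assumes "i < n + 1" "j < n + 1"
  shows "shear_mat n a $$ (i, j) = (if i = j then 1 else if j = n then a i else 0)"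
  using assms by (auto simp: shear_mat_def)

text \<open>With \<open>inj_on_shear_mat\<close> and \<open>shear_mat_add\<close> this identifies
  the group with the additive group \<open>F^n\<close>, so that sums over the group become sums over
  \<open>col_space n\<close>.\<close>

lemma carrier_Hgrp: "carrier (Hgrp n) = shear_mat n ` col_space n"
proof (intro subset_antisym subsetI)
  fix g :: "'a mat" assume "g \<in> carrier (Hgrp n)"
  then obtain m where m: "m \<in> carrier_mat n 1"
      "g = four_block_mat (1\<^sub>m n) m (0\<^sub>m 1 n) (1\<^sub>m 1)"
    by (auto simp: Hgrp_def)
  let ?a = "\<lambda>i. if i < n then m $$ (i, 0) else 0"
  have "m = mat n 1 (\<lambda>(i, j). ?a i)"
    using m(1) by (intro eq_matI) auto
  then have "g = shear_mat n ?a"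
    using m(2) by (simp add: shear_mat_def)
  moreover have "?a \<in> col_space n"
    by (simp add: col_space_def)
  ultimately show "g \<in> shear_mat n ` col_space n" by blast
next
  fix g :: "'a mat" assume "g \<in> shear_mat n ` col_space n"
  then show "g \<in> carrier (Hgrp n)"
    by (fastforce simp: Hgrp_def shear_mat_def)
qed

lemma inj_on_shear_mat: "inj_on (shear_mat n) (col_space n)"
proof (intro inj_onI ext)
  fix a b :: "nat \<Rightarrow> 'a" and i
  assume ab: "a \<in> col_space n" "b \<in> col_space n" "shear_mat n a = shear_mat n b"
  show "a i = b i"
  proof (cases "i < n")
    case True
    then have "shear_mat n a $$ (i, n) = a i" "shear_mat n b $$ (i, n) = b i"
      by (simp_all add: shear_mat_index)
    with ab(3) show ?thesis by simp
  qed (use ab in \<open>simp add: col_space_def\<close>)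
qed

lemma shear_mat_add: "shear_mat n (a + b) = shear_mat n a * shear_mat n b"
proof -
  let ?c = "\<lambda>a. mat n 1 (\<lambda>(i, j). a i) :: 'a mat"
  have c: "?c a \<in> carrier_mat n 1" for a
    by simp
  have "?c (a + b) = ?c b + ?c a"
    by (intro eq_matI) auto
  then show ?thesis
    unfolding shear_mat_def
    by (subst mult_four_block_mat[of _ n n _ 1 _ 1 _ _ n _ 1]) (auto simp: c)
qed

lemma mat_app_shear_mat:
  assumes a: "a \<in> col_space n" and w: "w \<in> col_space (n + 1)"
  shows "mat_app (shear_mat n a) w = w + fscale (w n) a"
proof
  fix i
  have dims: "dim_row (shear_mat n a) = n + 1" "dim_col (shear_mat n a) = n + 1"
    using shear_mat_carrier by blast+
  show "mat_app (shear_mat n a) w i = (w + fscale (w n) a) i"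
  proof (cases "i < n + 1")
    case True
    have "mat_app (shear_mat n a) w i = (\<Sum>j = 0..<Suc n. shear_mat n a $$ (i, j) * w j)"
      using True by (simp add: mat_app_def fun_of_vec_def dims scalar_prod_def)
    also have "\<dots> = (\<Sum>j = 0..<Suc n. (if j = i then w j else 0) + (if j = n then a i * w j else 0))"
    proof (intro sum.cong refl)
      fix j assume "j \<in> {0..<Suc n}"
      then show "shear_mat n a $$ (i, j) * w j
          = (if j = i then w j else 0) + (if j = n then a i * w j else 0)"
        using True a by (auto simp: shear_mat_index col_space_def)
    qed
    also have "\<dots> = w i + a i * w n"
      using True by (simp only: sum.distrib sum.delta) auto
    finally show ?thesis
      by (simp add: fscale_apply mult.commute)
  next
    case False
    then show ?thesis
      using a w by (simp add: mat_app_def fun_of_vec_def dims fscale_apply col_space_def)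
  qed
qed

text \<open>The shear adds \<open>w n\<close> times \<open>a\<close> to \<open>w\<close> and keeps
  coordinate \<open>n\<close>, because \<open>a\<close> vanishes there; subtracting the same
  multiple undoes it.\<close>

lemma mat_app_cone:
  fixes Z :: "(nat \<Rightarrow> 'a::{field,finite}) set"
  assumes Z: "Z \<in> Bq n" and a: "a \<in> col_space n" and b: "b \<in> col_space n"
  shows "mat_app (shear_mat n a) ` cone n Z b = cone n Z (b + a)"
proof -
  have an: "a n = 0" using a by (simp add: col_space_def)
  have sub: "cone n Z b \<subseteq> col_space (n + 1)"
    using affine_partD(2)[OF cone_in_affine_part(1)[OF Z b]] .
  have "mat_app (shear_mat n a) ` cone n Z b = (\<lambda>w. w + fscale (w n) a) ` cone n Z b"
    by (rule image_cong[OF refl]) (use sub mat_app_shear_mat[OF a] in blast)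
  also have "\<dots> = cone n Z (b + a)"
  proof (intro subset_antisym subsetI)
    fix w assume "w \<in> (\<lambda>w. w + fscale (w n) a) ` cone n Z b"
    then obtain v where v: "v \<in> cone n Z b" "w = v + fscale (v n) a" by blast
    then have "w n = v n" by (simp add: an fscale_apply)
    then show "w \<in> cone n Z (b + a)"
      using v by (simp add: cone_def fn.scale_right_distrib algebra_simps)
  next
    fix w assume w: "w \<in> cone n Z (b + a)"
    let ?v = "w - fscale (w n) a"
    have "?v n = w n" by (simp add: an fscale_apply)
    moreover from this have "?v \<in> cone n Z b"
      using w by (simp add: cone_def fn.scale_right_distrib algebra_simps)
    ultimately show "w \<in> (\<lambda>w. w + fscale (w n) a) ` cone n Z b"
      by (intro image_eqI[of _ _ ?v]) simp_all
  qed
  finally show ?thesis .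
qed

lemma affine_part_coneE:
  fixes Y :: "(nat \<Rightarrow> 'a::{field,finite}) set"
  assumes "Y \<in> affine_part n"
  obtains Z b where "Z \<in> Bq n" "b \<in> col_space n" "Y = cone n Z b"
proof -
  obtain b where b: "b \<in> slice n Y"
    using affine_partD(6)[OF assms] by blast
  then have "b \<in> col_space n"
    by (simp add: slice_def)
  with that[OF affine_partD(5)[OF assms] _ cone_slice[OF assms b, symmetric]] show thesis
    by blast
qed

text \<open>\<open>Hact\<close> moves basis elements forward, so the new coefficient at a subspace
  is the old one at its preimage, which is found with the inverse shear
  \<open>shear_mat n (- a)\<close>.\<close>

lemma Hact_cone:
  fixes Z :: "(nat \<Rightarrow> 'a::{field,finite}) set"
  assumes Z: "Z \<in> Bq n" and a: "a \<in> col_space n" and b: "b \<in> col_space n"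
  shows "Hact n (shear_mat n a) w (cone n Z b) = w (cone n Z (b - a))"
proof -
  have ba: "b - a \<in> col_space n" and na: "- a \<in> col_space n"
    using a b fn.subspace_diff fn.subspace_neg subspace_col_space by blast+
  have "mat_app (shear_mat n a) ` Y = cone n Z b \<longleftrightarrow> Y = cone n Z (b - a)"
    if Y: "Y \<in> affine_part n" for Y
  proof
    assume eq: "mat_app (shear_mat n a) ` Y = cone n Z b"
    obtain Z' b' where Y': "Z' \<in> Bq n" "b' \<in> col_space n" "Y = cone n Z' b'"
      using affine_part_coneE[OF Y] .
    have b'a: "b' + a \<in> col_space n"
      using a Y'(2) fn.subspace_add subspace_col_space by blast
    have "Y = mat_app (shear_mat n (- a)) ` mat_app (shear_mat n a) ` Y"
      unfolding Y'(3) mat_app_cone[OF Y'(1) a Y'(2)] mat_app_cone[OF Y'(1) na b'a] by simp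
    also have "\<dots> = cone n Z (b - a)"
      unfolding eq mat_app_cone[OF Z na b] by simp
    finally show "Y = cone n Z (b - a)" .
  next
    assume "Y = cone n Z (b - a)"
    then show "mat_app (shear_mat n a) ` Y = cone n Z b"
      using mat_app_cone[OF Z a ba] by simp
  qed
  then have "unit_fun (mat_app (shear_mat n a) ` Y) (cone n Z b)
      = (if Y = cone n Z (b - a) then 1 else 0 :: complex)" if "Y \<in> affine_part n" for Y
    unfolding unit_fun_apply eq_commute[of "cone n Z b"] using that by simp
  then have "Hact n (shear_mat n a) w (cone n Z b)
      = (\<Sum>Y\<in>affine_part n. if Y = cone n Z (b - a) then w Y else 0)"
    unfolding Hact_def lin_ext_apply
    by (intro sum.cong refl) simp
  also have "\<dots> = w (cone n Z (b - a))"
    using cone_in_affine_part(1)[OF Z ba] by simp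
  finally show ?thesis .
qed

lemma Hact_outside:
  fixes Y :: "(nat \<Rightarrow> 'a::{field,finite}) set"
  assumes a: "a \<in> col_space n" and Y: "Y \<notin> affine_part n"
  shows "Hact n (shear_mat n a) w Y = 0"
  unfolding Hact_def lin_ext_apply
proof (rule sum.neutral, rule ballI)
  fix Y' :: "(nat \<Rightarrow> 'a) set" assume "Y' \<in> affine_part n"
  then obtain Z b where Z: "Z \<in> Bq n" "b \<in> col_space n" "Y' = cone n Z b"
    by (rule affine_part_coneE)
  have "b + a \<in> col_space n"
    using a Z(2) fn.subspace_add subspace_col_space by blast
  from cone_in_affine_part(1)[OF Z(1) this] have "Y \<noteq> mat_app (shear_mat n a) ` Y'"
    using Y unfolding Z(3) mat_app_cone[OF Z(1) a Z(2)] by blast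
  then show "w Y' * unit_fun (mat_app (shear_mat n a) ` Y') Y = 0"
    by (simp add: unit_fun_apply)
qed

locale Hgrp_character =
  fixes n :: nat and chi :: "'a::{field,finite} mat \<Rightarrow> complex"
  assumes chi: "chi \<in> nontriv_chars n"

sublocale Hgrp_character \<subseteq> additive_character n "\<lambda>a. chi (shear_mat n a)"
proof
  have hom: "chi \<in> hom (Hgrp n) Cstar"
    using chi by (simp add: nontriv_chars_def)
  fix a b :: "nat \<Rightarrow> 'a"
  assume a: "a \<in> col_space n"
  then have a': "shear_mat n a \<in> carrier (Hgrp n)"
    by (auto simp: carrier_Hgrp)
  then show "chi (shear_mat n a) \<noteq> 0"
    using hom_in_carrier[OF hom] by (simp add: Cstar_def)
  assume "b \<in> col_space n"
  then have "shear_mat n b \<in> carrier (Hgrp n)"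
    by (auto simp: carrier_Hgrp)
  from hom_mult[OF hom a' this]
  show "chi (shear_mat n (a + b)) = chi (shear_mat n a) * chi (shear_mat n b)"
    by (simp add: Hgrp_def Cstar_def shear_mat_add)
next
  show "\<exists>a\<in>col_space n. chi (shear_mat n a) \<noteq> 1"
    using chi by (simp add: nontriv_chars_def carrier_Hgrp)
qed

section \<open>The projection \<open>char_proj\<close> and the hyperplane of the character\<close>

context Hgrp_character begin

text \<open>The shear by \<open>a\<close> contributes at \<open>Y\<close> exactly when it carries
  \<open>hat n Z\<close> to \<open>Y\<close>, that is, when \<open>Y\<close> has trace
  \<open>Z\<close> and \<open>a\<close> lies in its slice. The slice has \<open>card Z\<close>
  elements, and \<open>khat Y\<close> is the average of their weights.\<close>

lemma char_proj_hat:
  assumes Z: "Z \<in> Bq n"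
  shows "char_proj n chi (unit_fun (hat n Z)) Y
    = (if Y \<in> affine_part n \<and> Y \<inter> V = Z then of_nat (card Z) * khat Y else 0)"
proof -
  have sum: "char_proj n chi (unit_fun (hat n Z)) Y
      = (\<Sum>a\<in>V. kap a * Hact n (shear_mat n a) (unit_fun (cone n Z 0)) Y)"
    unfolding char_proj_def carrier_Hgrp hat_eq_cone[OF Z]
    by (simp add: sum_apply fscale_apply sum.reindex[OF inj_on_shear_mat] kap_def)
  show ?thesis
  proof (cases "Y \<in> affine_part n")
    case False
    then show ?thesis
      by (simp add: sum Hact_outside)
  next
    case True
    obtain Z' b where Y: "Z' \<in> Bq n" "b \<in> V" "Y = cone n Z' b"
      using affine_part_coneE[OF True] .
    have cap: "Y \<inter> V = Z'"
      using cone_in_affine_part(2)[OF Y(1,2)] Y(3) by simp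
    have "cone n Z' (b - a) = cone n Z 0 \<longleftrightarrow> Z' = Z \<and> a \<in> slice n Y" if "a \<in> V" for a
    proof -
      have "cone n Z 0 = cone n Z' (b - a) \<longleftrightarrow> Z' = Z \<and> 0 \<in> slice n (cone n Z' (b - a))"
        using cone_eq_iff[OF Z V_closed(1) cone_in_affine_part(1)[OF Y(1), of "b - a"]]
          cone_in_affine_part(2)[OF Y(1), of "b - a"] Y(2) that by simp
      also have "0 \<in> slice n (cone n Z' (b - a)) \<longleftrightarrow> a - b \<in> Z'"
        using slice_cone[OF Y(1), of "b - a"] Y(2) that by simp
      also have "\<dots> \<longleftrightarrow> a \<in> slice n Y"
        using slice_cone[OF Y(1,2)] Y(3) that by simp
      finally show ?thesis
        unfolding eq_commute[of "cone n Z' (b - a)"] .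
    qed
    then have "char_proj n chi (unit_fun (hat n Z)) Y
        = (\<Sum>a\<in>V. if Z' = Z \<and> a \<in> slice n Y then kap a else 0)"
      unfolding sum by (intro sum.cong refl) (auto simp: Y Hact_cone unit_fun_apply)
    also have "\<dots> = (if Z' = Z then \<Sum>a\<in>slice n Y. kap a else 0)"
      using slice_subset[of Y]
      by (auto simp: sum.inter_restrict[symmetric] Int_absorb1 intro!: sum.mono_neutral_cong_right)
    also have "\<dots> = (if Y \<inter> V = Z then of_nat (card Z) * khat Y else 0)"
      using card_subspace_pos[OF BqD(1,3)[OF Z]] card_slice[OF True]
      by (simp add: khat_def cap)
    finally show ?thesis
      using True by simp
  qed
qed

text \<open>The slice of \<open>hat n Z\<close> contains 0, where \<open>kap\<close> is 1, so for
  \<open>Z\<close> in \<open>ker\<close> the coefficient at \<open>hat n Z\<close> itself is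
  nonzero. Otherwise \<open>khat\<close> vanishes at every \<open>Y\<close> with trace
  \<open>Z\<close>.\<close>

lemma char_proj_hat_nonzero_iff:
  assumes Z: "Z \<in> Bq n"
  shows "char_proj n chi (unit_fun (hat n Z)) \<noteq> 0 \<longleftrightarrow> Z \<subseteq> ker"
proof
  assume "char_proj n chi (unit_fun (hat n Z)) \<noteq> 0"
  then obtain Y where "char_proj n chi (unit_fun (hat n Z)) Y \<noteq> 0"
    by (auto simp: fun_eq_iff)
  then have Y: "Y \<in> affine_part n" "Y \<inter> V = Z" "khat Y \<noteq> 0"
    by (auto simp: char_proj_hat[OF Z] split: if_splits)
  obtain b where "b \<in> slice n Y"
    using affine_partD(6)[OF Y(1)] by blast
  from khat_eq[OF Y(1) this] show "Z \<subseteq> ker"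
    using Y by (simp split: if_splits)
next
  assume sub: "Z \<subseteq> ker"
  let ?Y = "cone n Z 0"
  note Y = cone_in_affine_part[OF Z V_closed(1)]
  have "0 \<in> slice n ?Y"
    using slice_cone[OF Z V_closed(1), of 0] fn.subspace_0[OF BqD(1)[OF Z]] by simp
  from khat_eq[OF Y(1) this] have "khat ?Y = 1"
    using sub Y(2) by simp
  then have "char_proj n chi (unit_fun (hat n Z)) ?Y \<noteq> 0"
    using Y card_subspace_pos[OF BqD(1,3)[OF Z]] by (auto simp: char_proj_hat[OF Z])
  then show "char_proj n chi (unit_fun (hat n Z)) \<noteq> 0"
    by auto
qed

text \<open>\<open>card_V_ker\<close> gives \<open>ker\<close> the right dimension; every candidate
  lies in \<open>ker\<close> by \<open>char_proj_hat_nonzero_iff\<close> and has the same size. This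
  includes the unique existence behind \<open>char_hyperplane\<close>.\<close>

lemma char_hyperplane_eq_ker: "char_hyperplane n chi = ker"
proof -
  have ker: "ker \<in> Bq n"
    using ker_subset subspace_ker by (simp add: Bq_def subspaces_of_def)
  note k = BqD[OF ker]
  have "CARD('a) ^ n = CARD('a) ^ (fn.dim ker + 1)"
    using card_V_ker card_subspace[OF k(1,3)] by (simp add: card_col_space)
  then have dim: "n = fn.dim ker + 1"
    using CARD_gt_1[where 'a = 'a] power_inject_exp by blast
  show ?thesis
    unfolding char_hyperplane_def
  proof (rule the_equality)
    show "ker \<in> Bq n \<and> fn.dim ker = n - 1 \<and> char_proj n chi (unit_fun (hat n ker)) \<noteq> 0"
      using ker dim char_proj_hat_nonzero_iff[OF ker] by simp
  next
    fix X assume X: "X \<in> Bq n \<and> fn.dim X = n - 1 \<and> char_proj n chi (unit_fun (hat n X)) \<noteq> 0"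
    then have sub: "X \<subseteq> ker"
      using char_proj_hat_nonzero_iff by blast
    have "fn.dim X = fn.dim ker"
      using X dim by linarith
    then have "card X = card ker"
      using card_subspace[OF BqD(1,3), of X n] card_subspace[OF k(1,3)] X by metis
    then show "X = ker"
      using card_subset_eq[OF k(3) sub] by simp
  qed
qed

text \<open>At \<open>Y\<close> only the summand for the trace of \<open>Y\<close> survives, and the
  normalising power of q cancels \<open>card Z\<close>.\<close>

lemma lambda_map_eq_lift: "lambda_map n chi u = lift u"
proof
  fix Y :: "(nat \<Rightarrow> 'a) set"
  have "lambda_map n chi u Y = (\<Sum>Z\<in>subspaces_of ker. u Z *
      (1 / of_nat CARD('a) ^ fn.dim Z * char_proj n chi (unit_fun (hat n Z)) Y))"
    by (simp add: lambda_map_def char_hyperplane_eq_ker lin_ext_apply fscale_apply)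
  also have "\<dots> = (\<Sum>Z\<in>subspaces_of ker. if Z = Y \<inter> V then lift u Y else 0)"
  proof (intro sum.cong refl)
    fix Z assume "Z \<in> subspaces_of ker"
    then have Z: "Z \<in> Bq n" "Z \<subseteq> ker"
      by (auto simp: subspaces_of_ker_Bq)
    have "(of_nat (card Z) :: complex) = of_nat CARD('a) ^ fn.dim Z"
      using card_subspace[OF BqD(1,3)[OF Z(1)]] by simp
    then show "u Z * (1 / of_nat CARD('a) ^ fn.dim Z * char_proj n chi (unit_fun (hat n Z)) Y)
        = (if Z = Y \<inter> V then lift u Y else 0)"
      using Z(2) by (auto simp: char_proj_hat[OF Z(1)] lift_def)
  qed
  also have "\<dots> = (if Y \<inter> V \<in> subspaces_of ker then lift u Y else 0)"
    using ker_subset by (subst sum.delta) (simp_all add: finite_subspaces_of finite_subset[OF ker_subset])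
  also have "\<dots> = lift u Y"
    using affine_partD(5)[of Y n] by (auto simp: lift_def subspaces_of_ker_Bq)
  finally show "lambda_map n chi u Y = lift u Y" .
qed

section \<open>The isotypic component as the image of \<open>lift\<close>\<close>

lemma lift_cone:
  assumes "Z \<in> Bq n" "b \<in> V"
  shows "lift u (cone n Z b) = (if Z \<subseteq> ker then u Z * kap b else 0)"
proof -
  have "b \<in> slice n (cone n Z b)"
    using slice_cone[OF assms, of b] fn.subspace_0[OF BqD(1)[OF assms(1)]] assms(2) by simp
  from khat_eq[OF cone_in_affine_part(1)[OF assms] this] show ?thesis
    using cone_in_affine_part[OF assms] by (simp add: lift_def)
qed

text \<open>Both sides of the eigenvector equation are 0 outside \<open>affine_part n\<close>, so it
  is tested at cones only, with \<open>Hact_cone\<close> for the left side.\<close>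

lemma isotypic_iff:
  "w \<in> isotypic n chi \<longleftrightarrow> w \<in> free_space (affine_part n) \<and>
    (\<forall>Z\<in>Bq n. \<forall>a\<in>V. \<forall>b\<in>V. w (cone n Z (b - a)) = chi (shear_mat n a) * w (cone n Z b))"
proof -
  have "Hact n (shear_mat n a) w = fscale (chi (shear_mat n a)) w \<longleftrightarrow>
      (\<forall>Z\<in>Bq n. \<forall>b\<in>V. w (cone n Z (b - a)) = chi (shear_mat n a) * w (cone n Z b))"
    if w: "w \<in> free_space (affine_part n)" and a: "a \<in> V" for a
  proof
    assume "Hact n (shear_mat n a) w = fscale (chi (shear_mat n a)) w"
    then have "Hact n (shear_mat n a) w Y = chi (shear_mat n a) * w Y" for Y
      by (simp add: fscale_apply)
    then show "\<forall>Z\<in>Bq n. \<forall>b\<in>V. w (cone n Z (b - a)) = chi (shear_mat n a) * w (cone n Z b)"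
      using Hact_cone a by metis
  next
    assume *: "\<forall>Z\<in>Bq n. \<forall>b\<in>V. w (cone n Z (b - a)) = chi (shear_mat n a) * w (cone n Z b)"
    show "Hact n (shear_mat n a) w = fscale (chi (shear_mat n a)) w"
    proof
      fix Y :: "(nat \<Rightarrow> 'a) set"
      show "Hact n (shear_mat n a) w Y = fscale (chi (shear_mat n a)) w Y"
      proof (cases "Y \<in> affine_part n")
        case True
        then obtain Z b where "Z \<in> Bq n" "b \<in> V" "Y = cone n Z b"
          by (rule affine_part_coneE)
        then show ?thesis
          using * a by (simp add: Hact_cone fscale_apply)
      next
        case False
        then show ?thesis
          using w a by (simp add: Hact_outside fscale_apply free_space_def)
      qed
    qed
  qed
  then show ?thesis
    unfolding isotypic_def carrier_Hgrp by auto
qed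

lemma lift_isotypic: "lift u \<in> isotypic n chi"
  unfolding isotypic_iff
proof (intro conjI ballI)
  show "lift u \<in> free_space (affine_part n)"
    by (simp add: free_space_def lift_def)
qed (simp add: lift_cone kap_diff mult_ac)

text \<open>Translating \<open>hat n Z\<close> to \<open>cone n Z b\<close> multiplies the value of
  \<open>w\<close> by \<open>kap b\<close>, as for a lift.\<close>

lemma isotypic_eq_lift:
  assumes "w \<in> isotypic n chi"
  shows "w = lift (\<lambda>Z. w (cone n Z 0))"
proof
  fix Y :: "(nat \<Rightarrow> 'a) set"
  have w: "w (cone n Z (b - a)) = chi (shear_mat n a) * w (cone n Z b)"
    if "Z \<in> Bq n" "a \<in> V" "b \<in> V" for Z a b
    using assms that by (simp add: isotypic_iff)
  show "w Y = lift (\<lambda>Z. w (cone n Z 0)) Y"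
  proof (cases "Y \<in> affine_part n")
    case True
    then obtain Z b where Y: "Z \<in> Bq n" "b \<in> V" "Y = cone n Z b"
      by (rule affine_part_coneE)
    \<comment> \<open>For \<open>z\<close> in \<open>Z\<close> the cones at 0 and at
      \<open>- z\<close> coincide, so the value is unchanged when multiplied by
      \<open>chi (shear_mat n z)\<close>; some \<open>z\<close> makes this factor different from
      1.\<close>
    have "w (cone n Z 0) = 0" if not_sub: "\<not> Z \<subseteq> ker"
    proof -
      note Z = BqD[OF Y(1)]
      obtain z where z: "z \<in> Z" "chi (shear_mat n z) \<noteq> 1"
        using subset_ker_iff[OF Z(1,2)] not_sub by blast
      have zV: "z \<in> V" using z Z by blast
      have "- z \<in> Z" using fn.subspace_neg[OF Z(1) z(1)] .
      then have "cone n Z 0 = cone n Z (0 - z)"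
        using cone_eq_iff[OF Y(1) V_closed(1) cone_in_affine_part(1)[OF Y(1), of "0 - z"]]
          cone_in_affine_part(2)[OF Y(1), of "0 - z"] slice_cone[OF Y(1), of "0 - z" 0] zV z
        by simp
      then show ?thesis
        using w[OF Y(1) zV V_closed(1)] z(2) by (metis mult_cancel_right1)
    qed
    moreover have "w Y = kap b * w (cone n Z 0)"
    proof -
      have "w (cone n Z 0) = chi (shear_mat n b) * w Y"
        using w[OF Y(1,2,2)] Y(3) by simp
      then show ?thesis
        using kap_psi[OF Y(2)] by (simp add: mult.assoc[symmetric])
    qed
    ultimately show ?thesis
      using lift_cone[OF Y(1,2)] Y(3) by simp
  next
    case False
    then show ?thesis
      using assms by (simp add: isotypic_iff free_space_def lift_def)
  qed
qed

end

section \<open>The intertwining isomorphism\<close>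

lemma lin_ext_add: "lin_ext S f (u + v) = lin_ext S f u + lin_ext S f v"
  by (simp add: lin_ext_def fn.scale_left_distrib sum.distrib)

lemma lin_ext_scale: "lin_ext S f (fscale c v) = fscale c (lin_ext S f v)"
  by (simp add: lin_ext_def fn.scale_sum_right fscale_apply[of c v])

lemma subspace_free_space: "fn.subspace (free_space S)"
  by (auto simp: fn.subspace_def free_space_def fscale_apply)

section \<open>Transport from the hyperplane to \<open>F^(n-1)\<close>\<close>

lemma bij_betw_image_subspaces_of:
  fixes f :: "(nat \<Rightarrow> 'a::field) \<Rightarrow> (nat \<Rightarrow> 'a)"
  assumes f: "bij_betw f U W" and W: "fn.subspace U"
    and add: "\<And>u v. f (u + v) = f u + f v" and scale: "\<And>c v. f (fscale c v) = fscale c (f v)"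
  shows "bij_betw (image f) (subspaces_of U) (subspaces_of W)"
proof -
  have f0: "f 0 = 0"
    using scale[of 0 0] by simp
  have inj: "inj_on f U" and img: "f ` U = W"
    using f by (auto simp: bij_betw_def)
  have image: "f ` Z \<in> subspaces_of W" if "Z \<in> subspaces_of U" for Z
  proof -
    have Z: "fn.subspace Z" "Z \<subseteq> U" using that by (auto simp: subspaces_of_def)
    have "fn.subspace (f ` Z)"
      unfolding fn.subspace_def
    proof (intro conjI ballI allI)
      show "0 \<in> f ` Z"
        using f0 fn.subspace_0[OF Z(1)] by (metis imageI)
    next
      fix x y assume "x \<in> f ` Z" "y \<in> f ` Z"
      then show "x + y \<in> f ` Z"
        using fn.subspace_add[OF Z(1)] by (auto simp flip: add)
    next
      fix c x assume "x \<in> f ` Z"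
      then show "fscale c x \<in> f ` Z"
        using fn.subspace_scale[OF Z(1)] by (auto simp flip: scale)
    qed
    then show ?thesis
      using Z(2) img by (auto simp: subspaces_of_def)
  qed
  have preimage: "{u \<in> U. f u \<in> Z} \<in> subspaces_of U" if "Z \<in> subspaces_of W" for Z
  proof -
    have Z: "fn.subspace Z" using that by (simp add: subspaces_of_def)
    show ?thesis
      using W f0 Z by (simp add: subspaces_of_def fn.subspace_def add scale)
  qed
  show ?thesis
  proof (rule bij_betw_byWitness[where f' = "\<lambda>Z. {u \<in> U. f u \<in> Z}"])
    show "\<forall>Z\<in>subspaces_of U. {u \<in> U. f u \<in> f ` Z} = Z"
      using inj_on_image_mem_iff[OF inj] unfolding subspaces_of_def by blast
    show "\<forall>Z\<in>subspaces_of W. f ` {u \<in> U. f u \<in> Z} = Z"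
      using img unfolding subspaces_of_def by blast
  qed (use image preimage in \<open>blast\<close>)+
qed

locale hyperplane_transport = Hgrp_character +
  assumes n_pos: "n \<ge> 1"
begin

abbreviation iso :: "(nat \<Rightarrow> 'a) \<Rightarrow> (nat \<Rightarrow> 'a)" where "iso \<equiv> tau n ker"

lemma bij_iso: "bij_betw iso (col_space (n - 1)) ker"
  by (rule bij_betw_tau[OF n_pos subspace_ker ker_subset])
    (use ker_neq ker_complement in auto)

lemma bij_image_iso: "bij_betw (image iso) (Bq (n - 1)) (subspaces_of ker)"
  unfolding Bq_def
  by (rule bij_betw_image_subspaces_of[OF bij_iso subspace_col_space tau_linear])

lemma card_image_iso:
  assumes "Y \<in> Bq (n - 1)" shows "card (iso ` Y) = card Y"
  using bij_betw_imp_inj_on[OF bij_iso] BqD(2)[OF assms]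
  by (intro card_image) (auto intro: inj_on_subset)

lemma image_iso_Bq: "Y \<in> Bq (n - 1) \<Longrightarrow> iso ` Y \<in> Bq n \<and> iso ` Y \<subseteq> ker"
  using bij_betwE[OF bij_image_iso] by (auto simp: subspaces_of_ker_Bq)

text \<open>The bijection preserves inclusions and cardinalities, and these determine
  \<open>covers\<close>.\<close>

lemma covers_image_iso:
  assumes Y: "Y \<in> Bq (n - 1)" "Y' \<in> Bq (n - 1)"
  shows "covers (iso ` Y') (iso ` Y) \<longleftrightarrow> covers Y' Y"
proof -
  note D = BqD[OF Y(1)] BqD[OF Y(2)]
  note E = BqD[OF conjunct1[OF image_iso_Bq[OF Y(1)]]] BqD[OF conjunct1[OF image_iso_Bq[OF Y(2)]]]
  have "iso ` Y \<subseteq> iso ` Y' \<longleftrightarrow> Y \<subseteq> Y'"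
    using inj_on_image_mem_iff[OF bij_betw_imp_inj_on[OF bij_iso] _ D(5)] D(2) by blast
  then show ?thesis
    by (simp only: covers_iff_card[OF D(1,3,4,6)] covers_iff_card[OF E(1,3,4,6)]
      card_image_iso[OF Y(1)] card_image_iso[OF Y(2)])
qed

lemma dim_image_iso:
  assumes Y: "Y \<in> Bq (n - 1)"
  shows "fn.dim (iso ` Y) = fn.dim Y"
proof -
  have "CARD('a) ^ fn.dim (iso ` Y) = CARD('a) ^ fn.dim Y"
    using card_image_iso[OF Y] card_subspace[OF BqD(1,3)[OF Y]]
      card_subspace[OF BqD(1,3)[OF conjunct1[OF image_iso_Bq[OF Y]]]] by simp
  then show ?thesis
    using CARD_gt_1[where 'a = 'a] power_inject_exp by blast
qed

lemma mu_map_image_iso: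
  assumes Y: "Y \<in> Bq (n - 1)"
  shows "mu_map n ker v (iso ` Y) = v Y"
proof -
  have "mu_map n ker v (iso ` Y) = (\<Sum>Y'\<in>Bq (n - 1). if Y' = Y then v Y' else 0)"
    unfolding mu_map_def lin_ext_apply
    by (intro sum.cong refl)
      (use inj_on_eq_iff[OF bij_betw_imp_inj_on[OF bij_image_iso]] Y in \<open>auto simp: unit_fun_apply\<close>)
  then show ?thesis
    using Y by simp
qed

lemma sum_mu_map:
  assumes "\<And>Y. Y \<in> Bq (n - 1) \<Longrightarrow> P (iso ` Y) \<longleftrightarrow> Q Y"
  shows "(\<Sum>Z | Z \<in> subspaces_of ker \<and> P Z. mu_map n ker v Z) = (\<Sum>Y | Y \<in> Bq (n - 1) \<and> Q Y. v Y)"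
proof -
  have "bij_betw (image iso) {Y. Y \<in> Bq (n - 1) \<and> Q Y} {Z. Z \<in> subspaces_of ker \<and> P Z}"
    unfolding bij_betw_def
  proof
    show "inj_on (image iso) {Y. Y \<in> Bq (n - 1) \<and> Q Y}"
      by (rule inj_on_subset[OF bij_betw_imp_inj_on[OF bij_image_iso]]) auto
    show "image iso ` {Y. Y \<in> Bq (n - 1) \<and> Q Y} = {Z. Z \<in> subspaces_of ker \<and> P Z}"
      using assms unfolding bij_betw_imp_surj_on[OF bij_image_iso, symmetric] by auto
  qed
  from sum.reindex_bij_betw[OF this, of "mu_map n ker v", symmetric] show ?thesis
    by (simp add: mu_map_image_iso)
qed

text \<open>A lift depends only on the values at subspaces of \<open>ker\<close>, all of them images
  of members of \<open>Bq (n - 1)\<close>, and it returns these values at the cones with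
  \<open>a = 0\<close>. Bijectivity and the intertwining relation thus reduce to functions on
  \<open>Bq (n - 1)\<close>.\<close>

lemma lift_eq_iff:
  "lift u = lift u' \<longleftrightarrow> (\<forall>Y\<in>Bq (n - 1). u (iso ` Y) = u' (iso ` Y))"
proof
  assume "lift u = lift u'"
  then show "\<forall>Y\<in>Bq (n - 1). u (iso ` Y) = u' (iso ` Y)"
    using image_iso_Bq lift_cone[OF _ V_closed(1)] by (metis kap_0 mult.right_neutral)
next
  assume *: "\<forall>Y\<in>Bq (n - 1). u (iso ` Y) = u' (iso ` Y)"
  have "u Z = u' Z" if "Z \<in> Bq n" "Z \<subseteq> ker" for Z
  proof -
    have "Z \<in> image iso ` Bq (n - 1)"
      using that unfolding bij_betw_imp_surj_on[OF bij_image_iso] subspaces_of_ker_Bq by blast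
    then show ?thesis using * by blast
  qed
  then show "lift u = lift u'"
    using affine_partD(5) by (auto simp: lift_def fun_eq_iff)
qed

lemma linear_iso_lambda_mu:
  "linear_iso_on (free_space (Bq (n - 1))) (isotypic n chi) (lambda_map n chi \<circ> mu_map n ker)"
  unfolding linear_iso_on_def
proof (intro conjI ballI allI)
  show "fn.subspace (isotypic n chi)"
    unfolding fn.subspace_def
  proof (intro conjI ballI allI)
    show "0 \<in> isotypic n chi"
      using fn.subspace_0[OF subspace_free_space] by (simp add: isotypic_iff)
  next
    fix u v assume "u \<in> isotypic n chi" "v \<in> isotypic n chi"
    then show "u + v \<in> isotypic n chi"
      using fn.subspace_add[OF subspace_free_space, of u "affine_part n" v]
      by (simp add: isotypic_iff distrib_left)
  next
    fix c v assume "v \<in> isotypic n chi"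
    then show "fscale c v \<in> isotypic n chi"
      using fn.subspace_scale[OF subspace_free_space, of v "affine_part n" c]
      by (simp add: isotypic_iff fscale_apply)
  qed
  show "bij_betw (lambda_map n chi \<circ> mu_map n ker) (free_space (Bq (n - 1))) (isotypic n chi)"
    unfolding bij_betw_def
  proof (intro conjI inj_onI subset_antisym)
    fix u v assume uv: "u \<in> free_space (Bq (n - 1))" "v \<in> free_space (Bq (n - 1))"
      "(lambda_map n chi \<circ> mu_map n ker) u = (lambda_map n chi \<circ> mu_map n ker) v"
    then have "u Y = v Y" if "Y \<in> Bq (n - 1)" for Y
      using that by (simp add: lambda_map_eq_lift lift_eq_iff mu_map_image_iso)
    then have "u Y = v Y" for Y
      using uv(1,2) by (cases "Y \<in> Bq (n - 1)") (simp_all add: free_space_def)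
    then show "u = v" by blast
  next
    show "(lambda_map n chi \<circ> mu_map n ker) ` free_space (Bq (n - 1)) \<subseteq> isotypic n chi"
      by (auto simp: lambda_map_eq_lift lift_isotypic)
    show "isotypic n chi \<subseteq> (lambda_map n chi \<circ> mu_map n ker) ` free_space (Bq (n - 1))"
    proof
      fix w assume w: "w \<in> isotypic n chi"
      \<comment> \<open>The preimage of \<open>w\<close> records its values at the
        \<open>hat n Z\<close> with \<open>Z\<close> in \<open>ker\<close>, pulled back to
        \<open>Bq (n - 1)\<close>.\<close>
      let ?v = "\<lambda>Y. if Y \<in> Bq (n - 1) then w (cone n (iso ` Y) 0) else 0"
      have "w = lift (\<lambda>Z. w (cone n Z 0))"
        by (rule isotypic_eq_lift[OF w])
      also have "\<dots> = lift (mu_map n ker ?v)"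
        unfolding lift_eq_iff by (simp add: mu_map_image_iso)
      finally have "w = (lambda_map n chi \<circ> mu_map n ker) ?v"
        by (simp add: lambda_map_eq_lift)
      moreover have "?v \<in> free_space (Bq (n - 1))"
        by (simp add: free_space_def)
      ultimately show "w \<in> (lambda_map n chi \<circ> mu_map n ker) ` free_space (Bq (n - 1))"
        by (rule image_eqI)
    qed
  qed
qed (simp_all add: subspace_free_space lambda_map_def mu_map_def lin_ext_add lin_ext_scale)

text \<open>By \<open>adj_op_lift\<close> both sides are lifts, compared at the images of members of
  \<open>Bq (n - 1)\<close>; there the two cover sums become those in
  \<open>adj_op (n - 1)\<close>.\<close>

lemma lambda_mu_adj_op:
  "(lambda_map n chi \<circ> mu_map n ker) (fscale (of_nat CARD('a)) (adj_op (n - 1) v)) =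
    adj_op (n + 1) ((lambda_map n chi \<circ> mu_map n ker) v)"
  unfolding comp_apply lambda_map_eq_lift adj_op_lift lift_eq_iff
proof
  fix Y :: "(nat \<Rightarrow> 'a) set" assume Y: "Y \<in> Bq (n - 1)"
  have "up_sum (mu_map n ker v) (iso ` Y) = (\<Sum>Y' | Y' \<in> Bq (n - 1) \<and> covers Y' Y. v Y')"
    by (rule sum_mu_map) (rule covers_image_iso[OF Y])
  moreover have "down_sum (mu_map n ker v) (iso ` Y) = (\<Sum>Y' | Y' \<in> Bq (n - 1) \<and> covers Y Y'. v Y')"
    by (rule sum_mu_map) (rule covers_image_iso[OF _ Y])
  ultimately show "mu_map n ker (fscale (of_nat CARD('a)) (adj_op (n - 1) v)) (iso ` Y)
      = of_nat CARD('a) * (down_sum (mu_map n ker v) (iso ` Y)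
        + of_nat CARD('a) ^ fn.dim (iso ` Y) * up_sum (mu_map n ker v) (iso ` Y))"
    using Y by (simp add: mu_map_image_iso fscale_apply adj_op_apply dim_image_iso)
qed

end

theorem theorem4p2:
  fixes n :: nat and chi :: "'a::{field,finite} mat \<Rightarrow> complex" and X :: "(nat \<Rightarrow> 'a) set"
  assumes "n \<ge> 1" and "chi \<in> nontriv_chars n" and "X = char_hyperplane n chi"
  shows "linear_iso_on (free_space (Bq (n - 1))) (isotypic n chi) (lambda_map n chi \<circ> mu_map n X) \<and>
    (\<forall>v \<in> free_space (Bq (n - 1)).
       (lambda_map n chi \<circ> mu_map n X) (fscale (of_nat CARD('a)) (adj_op (n - 1) v)) =
       adj_op (n + 1) ((lambda_map n chi \<circ> mu_map n X) v))"
proof -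
  interpret hyperplane_transport n chi
    using assms by unfold_locales
  show ?thesis
    unfolding assms(3) char_hyperplane_eq_ker
    using linear_iso_lambda_mu lambda_mu_adj_op by blast
qed

end
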